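(* Let $W$ be a finitely generated Coxeter group and let $(W,S)$ be any Coxeter system for $W$. Then the maximal FA subgroups of $W$ are precisely the conjugates in $W$ of the special subgroups $\langle A\rangle$, $A\subseteq S$, such that the induced subgraph of the presentation diagram $\Gamma(W,S)$ on $A$ is a maximal complete subgraph of $\Gamma(W,S)$.
   Context: A Coxeter system $(W,S)$ is a group $W$ with generating set $S$ having a presentation $\langle S : (st)^{m(s,t)}\ (s,t\in S,\ m(s,t)<\infty)\rangle$, where $m:S^2\to\{1,2,\ldots,\infty\}$, $m(s,t)=m(t,s)$, and $m(s,t)=1$ iff $s=t$. A special subgroup is a subgroup $\langle A\rangle$ generated by a subset $A\subseteq S$. The presentation diagram $\Gamma(W,S)$ is the labeled graph with vertex set $S$ and an undirected edge labeled $m(s,t)$ between distinct $s,t\in S$ exactly when $m(s,t)<\infty$. A subgraph is complete if every two of its distinct vertices are joined by an edge. A group $G$ is FA if for every tree on which $G$ acts (without edge inversions, i.e. the tree is a directed graph and the action preserves orientation of edges), the set of fixed points of $G$ in the tree is nonempty. A maximal FA subgroup of $W$ is a subgroup that is FA and is maximal under inclusion among FA subgroups of $W$. *)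

theory Defs
  imports
    "HOL-Algebra.Generated_Groups"
    "HOL-Algebra.Group_Action"
    "HOL-Library.Extended_Nat"
begin

section \<open>Group presentations\<close>

text \<open>
  A word over \<open>S\<close> is a list of letters; \<open>(s, True)\<close> stands for \<open>s\<close> and \<open>(s, False)\<close> for its
  formal inverse.
\<close>

type_synonym 'a word = "('a \<times> bool) list"

fun word_eval :: "('a, 'b) monoid_scheme \<Rightarrow> 'a word \<Rightarrow> 'a" where
  "word_eval G [] = \<one>\<^bsub>G\<^esub>"
| "word_eval G ((s, b) # w) = (if b then s else inv\<^bsub>G\<^esub> s) \<otimes>\<^bsub>G\<^esub> word_eval G w"

text \<open>
  Two words over \<open>S\<close> are related iff the elements of the free group on \<open>S\<close> they represent
  agree modulo the normal closure of \<open>R\<close>.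
\<close>

inductive word_equiv :: "'a set \<Rightarrow> 'a word set \<Rightarrow> 'a word \<Rightarrow> 'a word \<Rightarrow> bool"
  for S :: "'a set" and R :: "'a word set" where
  refl: "word_equiv S R w w"
| sym: "word_equiv S R v w \<Longrightarrow> word_equiv S R w v"
| trans: "word_equiv S R u v \<Longrightarrow> word_equiv S R v w \<Longrightarrow> word_equiv S R u w"
| cancel: "s \<in> S \<Longrightarrow> word_equiv S R (u @ [(s, b), (s, \<not> b)] @ v) (u @ v)"
| relator: "r \<in> R \<Longrightarrow> word_equiv S R (u @ r @ v) (u @ v)"

definition has_presentation :: "('a, 'b) monoid_scheme \<Rightarrow> 'a set \<Rightarrow> 'a word set \<Rightarrow> bool" where
  "has_presentation G S R \<longleftrightarrow>
     group G \<and> S \<subseteq> carrier G \<and> generate G S = carrier G \<and> R \<subseteq> lists (S \<times> UNIV) \<and>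
     (\<forall>w \<in> lists (S \<times> UNIV). word_eval G w = \<one>\<^bsub>G\<^esub> \<longleftrightarrow> word_equiv S R w [])"

definition finitely_generated :: "('a, 'b) monoid_scheme \<Rightarrow> bool" where
  "finitely_generated G \<longleftrightarrow> (\<exists>X. finite X \<and> X \<subseteq> carrier G \<and> generate G X = carrier G)"


section \<open>Coxeter systems\<close>

definition coxeter_matrix :: "'a set \<Rightarrow> ('a \<Rightarrow> 'a \<Rightarrow> enat) \<Rightarrow> bool" where
  "coxeter_matrix S m \<longleftrightarrow>
     (\<forall>s\<in>S. \<forall>t\<in>S. 1 \<le> m s t \<and> m s t = m t s \<and> (m s t = 1 \<longleftrightarrow> s = t))"

definition coxeter_relators :: "'a set \<Rightarrow> ('a \<Rightarrow> 'a \<Rightarrow> enat) \<Rightarrow> 'a word set" where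
  "coxeter_relators S m =
     {concat (replicate n [(s, True), (t, True)]) | s t n. s \<in> S \<and> t \<in> S \<and> m s t = enat n}"

definition coxeter_system ::
    "('a, 'b) monoid_scheme \<Rightarrow> 'a set \<Rightarrow> ('a \<Rightarrow> 'a \<Rightarrow> enat) \<Rightarrow> bool" where
  "coxeter_system W S m \<longleftrightarrow>
     coxeter_matrix S m \<and> has_presentation W S (coxeter_relators S m)"


section \<open>Labeled graphs and the presentation diagram\<close>

text \<open>An edge is a pair consisting of its set of endpoints and its label.\<close>

record 'v labeled_graph =
  verts :: "'v set"
  edges :: "('v set \<times> nat) set"

definition subgraph :: "'v labeled_graph \<Rightarrow> 'v labeled_graph \<Rightarrow> bool" where
  "subgraph D G \<longleftrightarrow> verts D \<subseteq> verts G \<and> edges D \<subseteq> edges G \<and> (\<forall>e \<in> edges D. fst e \<subseteq> verts D)"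

definition induced_subgraph :: "'v labeled_graph \<Rightarrow> 'v set \<Rightarrow> 'v labeled_graph" where
  "induced_subgraph G A = \<lparr>verts = A, edges = {e \<in> edges G. fst e \<subseteq> A}\<rparr>"

definition complete_graph :: "'v labeled_graph \<Rightarrow> bool" where
  "complete_graph G \<longleftrightarrow> (\<forall>x \<in> verts G. \<forall>y \<in> verts G. x \<noteq> y \<longrightarrow> (\<exists>n. ({x, y}, n) \<in> edges G))"

definition maximal_complete_subgraph :: "'v labeled_graph \<Rightarrow> 'v labeled_graph \<Rightarrow> bool" where
  "maximal_complete_subgraph D G \<longleftrightarrow>
     subgraph D G \<and> complete_graph D \<and>
     (\<forall>D'. subgraph D' G \<and> complete_graph D' \<and> subgraph D D' \<longrightarrow> D' = D)"

definition presentation_diagram :: "'a set \<Rightarrow> ('a \<Rightarrow> 'a \<Rightarrow> enat) \<Rightarrow> 'a labeled_graph" where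
  "presentation_diagram S m =
     \<lparr>verts = S, edges = {({s, t}, n) | s t n. s \<in> S \<and> t \<in> S \<and> s \<noteq> t \<and> m s t = enat n}\<rparr>"


section \<open>Trees and groups with property FA\<close>

text \<open>
  A directed tree is a nonempty directed graph whose underlying undirected graph is connected and
  has no circuits. Circuits of length one (loops) and of length two (pairs of opposite edges) are
  excluded by asymmetry of the edge relation; as multiple edges are excluded too, edges can be
  taken to be ordered pairs of vertices.
\<close>

definition directed_tree :: "'v set \<Rightarrow> ('v \<times> 'v) set \<Rightarrow> bool" where
  "directed_tree V E \<longleftrightarrow>
     V \<noteq> {} \<and> E \<subseteq> V \<times> V \<and>
     (\<forall>x\<in>V. \<forall>y\<in>V. (x, y) \<in> (E \<union> E\<inverse>)\<^sup>*) \<and>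
     asym E \<and>
     \<not> (\<exists>p. 3 \<le> length p \<and> distinct p \<and>
            successively (\<lambda>x y. (x, y) \<in> E \<union> E\<inverse>) p \<and> (last p, hd p) \<in> E \<union> E\<inverse>)"

definition acts_on_tree ::
    "('a, 'b) monoid_scheme \<Rightarrow> 'v set \<Rightarrow> ('v \<times> 'v) set \<Rightarrow> ('a \<Rightarrow> 'v \<Rightarrow> 'v) \<Rightarrow> bool" where
  "acts_on_tree G V E \<phi> \<longleftrightarrow>
     directed_tree V E \<and> group_action G V \<phi> \<and>
     (\<forall>g \<in> carrier G. \<forall>(x, y) \<in> E. (\<phi> g x, \<phi> g y) \<in> E)"

text \<open>
  Since edge orientations are preserved, an edge can only be fixed along with both its endpoints,
  so it suffices to ask for a fixed vertex. A definition cannot quantify over all vertex types;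
  the type used here is large enough for every action of \<open>G\<close> on a tree with vertices of
  an arbitrary type to be covered, as \<open>FA_fixed_vertex\<close> below shows.
\<close>

definition FA :: "('a, 'b) monoid_scheme \<Rightarrow> bool" where
  "FA G \<longleftrightarrow>
     (\<forall>(V :: ('a \<times> 'a \<times> nat) set) E \<phi>. acts_on_tree G V E \<phi> \<longrightarrow>
        (\<exists>v\<in>V. \<forall>g \<in> carrier G. \<phi> g v = v))"

definition maximal_FA_subgroup :: "('a, 'b) monoid_scheme \<Rightarrow> 'a set \<Rightarrow> bool" where
  "maximal_FA_subgroup G H \<longleftrightarrow>
     subgroup H G \<and> FA (G\<lparr>carrier := H\<rparr>) \<and>
     (\<forall>K. subgroup K G \<and> FA (G\<lparr>carrier := K\<rparr>) \<and> H \<subseteq> K \<longrightarrow> K = H)"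


subsection \<open>Independence of the vertex type\<close>

lemma acts_on_treeI:
  assumes "group G" "directed_tree V E"
    and bij: "\<And>g. g \<in> carrier G \<Longrightarrow> \<phi> g \<in> extensional V"
    and closed: "\<And>g x. g \<in> carrier G \<Longrightarrow> x \<in> V \<Longrightarrow> \<phi> g x \<in> V"
    and one: "\<And>x. x \<in> V \<Longrightarrow> \<phi> \<one>\<^bsub>G\<^esub> x = x"
    and mult: "\<And>g h x. g \<in> carrier G \<Longrightarrow> h \<in> carrier G \<Longrightarrow> x \<in> V \<Longrightarrow>
                 \<phi> (g \<otimes>\<^bsub>G\<^esub> h) x = \<phi> g (\<phi> h x)"
    and edge: "\<And>g x y. g \<in> carrier G \<Longrightarrow> (x, y) \<in> E \<Longrightarrow> (\<phi> g x, \<phi> g y) \<in> E"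
  shows "acts_on_tree G V E \<phi>"
proof -
  interpret group G by fact
  have bb: "bij_betw (\<phi> g) V V" if g: "g \<in> carrier G" for g
  proof (rule bij_betw_byWitness[where f' = "\<phi> (inv\<^bsub>G\<^esub> g)"])
    show "\<forall>a\<in>V. \<phi> (inv\<^bsub>G\<^esub> g) (\<phi> g a) = a"
      using g mult[of "inv\<^bsub>G\<^esub> g" g, symmetric] one by simp
    show "\<forall>a\<in>V. \<phi> g (\<phi> (inv\<^bsub>G\<^esub> g) a) = a"
      using g mult[of g "inv\<^bsub>G\<^esub> g", symmetric] one by simp
  qed (use g closed in auto)
  have Bij: "\<phi> g \<in> Bij V" if "g \<in> carrier G" for g
    using that bij bb by (simp add: Bij_def)
  have "\<phi> \<in> hom G (BijGroup V)"
  proof (rule homI)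
    fix g h assume gh: "g \<in> carrier G" "h \<in> carrier G"
    have "\<phi> (g \<otimes>\<^bsub>G\<^esub> h) = compose V (\<phi> g) (\<phi> h)"
    proof (rule extensionalityI[of _ V])
      show "\<phi> (g \<otimes>\<^bsub>G\<^esub> h) \<in> extensional V" using gh bij by simp
      show "compose V (\<phi> g) (\<phi> h) \<in> extensional V" by (simp add: compose_def)
      show "\<phi> (g \<otimes>\<^bsub>G\<^esub> h) x = compose V (\<phi> g) (\<phi> h) x" if "x \<in> V" for x
        using that gh mult by (simp add: compose_def)
    qed
    then show "\<phi> (g \<otimes>\<^bsub>G\<^esub> h) = \<phi> g \<otimes>\<^bsub>BijGroup V\<^esub> \<phi> h"
      using gh Bij by (simp add: BijGroup_def)
  qed (simp add: BijGroup_def Bij)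
  then have "group_hom G (BijGroup V) \<phi>"
    by (simp add: group_hom_def group_hom_axioms_def group_BijGroup is_group)
  then show ?thesis
    using assms(2) edge by (auto simp: acts_on_tree_def group_action_def)
qed

lemma acts_on_treeD:
  assumes "acts_on_tree G V E \<phi>"
  shows "group G" "directed_tree V E"
    and "\<And>g x. g \<in> carrier G \<Longrightarrow> x \<in> V \<Longrightarrow> \<phi> g x \<in> V"
    and "\<And>x. x \<in> V \<Longrightarrow> \<phi> \<one>\<^bsub>G\<^esub> x = x"
    and "\<And>g h x. g \<in> carrier G \<Longrightarrow> h \<in> carrier G \<Longrightarrow> x \<in> V \<Longrightarrow>
           \<phi> (g \<otimes>\<^bsub>G\<^esub> h) x = \<phi> g (\<phi> h x)"
    and "\<And>g x y. g \<in> carrier G \<Longrightarrow> (x, y) \<in> E \<Longrightarrow> (\<phi> g x, \<phi> g y) \<in> E"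
proof -
  have act: "group_action G V \<phi>" using assms by (simp add: acts_on_tree_def)
  interpret group_action G V \<phi> by (rule act)
  show "group G" using group_hom by (simp add: group_hom_def)
  show "directed_tree V E" using assms by (simp add: acts_on_tree_def)
  show "\<phi> g x \<in> V" if "g \<in> carrier G" "x \<in> V" for g x
    using element_image[OF that HOL.refl] .
  show "\<phi> \<one>\<^bsub>G\<^esub> x = x" if "x \<in> V" for x
    using fun_cong[OF id_eq_one, of x] that by simp
  show "\<phi> (g \<otimes>\<^bsub>G\<^esub> h) x = \<phi> g (\<phi> h x)"
    if "g \<in> carrier G" "h \<in> carrier G" "x \<in> V" for g h x
    using composition_rule[OF that(3,1,2)] .
  show "(\<phi> g x, \<phi> g y) \<in> E" if "g \<in> carrier G" "(x, y) \<in> E" for g x y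
    using assms that by (auto simp: acts_on_tree_def)
qed

lemma directed_tree_subtree:
  assumes T: "directed_tree V E" and U: "U \<noteq> {}" "U \<subseteq> V"
    and conn: "\<And>x. x \<in> U \<Longrightarrow> (v, x) \<in> ((E \<inter> U \<times> U) \<union> (E \<inter> U \<times> U)\<inverse>)\<^sup>*"
  shows "directed_tree U (E \<inter> U \<times> U)"
proof -
  let ?F = "E \<inter> U \<times> U"
  have "sym (?F \<union> ?F\<inverse>)" by (rule sym_Un_converse)
  then have s: "sym ((?F \<union> ?F\<inverse>)\<^sup>*)" by (rule sym_rtrancl)
  have "(x, y) \<in> (?F \<union> ?F\<inverse>)\<^sup>*" if "x \<in> U" "y \<in> U" for x y
    using conn that symD[OF s] by (meson rtrancl_trans)
  moreover have "asym ?F"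
    using T by (auto simp: directed_tree_def asym_on_def)
  moreover have "\<not> (\<exists>p. 3 \<le> length p \<and> distinct p \<and>
            successively (\<lambda>x y. (x, y) \<in> ?F \<union> ?F\<inverse>) p \<and> (last p, hd p) \<in> ?F \<union> ?F\<inverse>)"
  proof
    assume "\<exists>p. 3 \<le> length p \<and> distinct p \<and>
            successively (\<lambda>x y. (x, y) \<in> ?F \<union> ?F\<inverse>) p \<and> (last p, hd p) \<in> ?F \<union> ?F\<inverse>"
    then obtain p where p: "3 \<le> length p" "distinct p"
      "successively (\<lambda>x y. (x, y) \<in> ?F \<union> ?F\<inverse>) p" "(last p, hd p) \<in> ?F \<union> ?F\<inverse>" by blast
    have "successively (\<lambda>x y. (x, y) \<in> E \<union> E\<inverse>) p"
      by (rule successively_mono[OF p(3)]) auto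
    then show False using p T unfolding directed_tree_def by blast
  qed
  ultimately show ?thesis using U by (auto simp: directed_tree_def)
qed

lemma directed_tree_image:
  assumes T: "directed_tree V E" and inj: "inj_on c V"
  shows "directed_tree (c ` V) (map_prod c c ` E)"
proof -
  define F where "F = map_prod c c ` E"
  have EV: "E \<subseteq> V \<times> V" and ne: "V \<noteq> {}" and asym: "asym E"
    and conn: "\<And>x y. x \<in> V \<Longrightarrow> y \<in> V \<Longrightarrow> (x, y) \<in> (E \<union> E\<inverse>)\<^sup>*"
    and circ: "\<And>p. \<lbrakk>3 \<le> length p; distinct p; successively (\<lambda>x y. (x, y) \<in> E \<union> E\<inverse>) p;
                  (last p, hd p) \<in> E \<union> E\<inverse>\<rbrakk> \<Longrightarrow> False"
    using T unfolding directed_tree_def by blast+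
  have F_I: "(c x, c y) \<in> F" if "(x, y) \<in> E" for x y
    unfolding F_def using that by (rule rev_image_eqI) simp
  have F_E: "\<exists>x y. (x, y) \<in> E \<and> a = c x \<and> b = c y" if "(a, b) \<in> F" for a b
    using that unfolding F_def by auto
  have FV: "F \<subseteq> c ` V \<times> c ` V"
    using EV unfolding F_def by auto
  have iff: "(c x, c y) \<in> F \<longleftrightarrow> (x, y) \<in> E" if xy: "x \<in> V" "y \<in> V" for x y
  proof
    assume "(c x, c y) \<in> F"
    then obtain a b where ab: "(a, b) \<in> E" "c x = c a" "c y = c b" using F_E by blast
    then have abV: "a \<in> V" "b \<in> V" using EV by auto
    have "x = a" using inj_onD[OF inj ab(2) xy(1) abV(1)] .
    moreover have "y = b" using inj_onD[OF inj ab(3) xy(2) abV(2)] .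
    ultimately show "(x, y) \<in> E" using ab(1) by simp
  qed (rule F_I)
  have iff': "(c x, c y) \<in> F \<union> F\<inverse> \<longleftrightarrow> (x, y) \<in> E \<union> E\<inverse>" if "x \<in> V" "y \<in> V" for x y
    using iff[OF that] iff[OF that(2,1)] by simp
  have "(c x, c y) \<in> (F \<union> F\<inverse>)\<^sup>*" if "(x, y) \<in> (E \<union> E\<inverse>)\<^sup>*" for x y
    using that
  proof (induction rule: rtrancl_induct)
    case (step y z)
    have "(c y, c z) \<in> F \<union> F\<inverse>" using step.hyps(2) F_I by blast
    with step.IH show ?case by (rule rtrancl.rtrancl_into_rtrancl)
  qed (rule rtrancl.rtrancl_refl)
  then have conn_F: "\<forall>a \<in> c ` V. \<forall>b \<in> c ` V. (a, b) \<in> (F \<union> F\<inverse>)\<^sup>*"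
    using conn by blast
  have asym_F: "asym F"
  proof (rule asymI)
    fix a b assume "(a, b) \<in> F"
    then obtain x y where xy: "(x, y) \<in> E" "a = c x" "b = c y" using F_E by blast
    then have V: "y \<in> V" "x \<in> V" using EV by auto
    have "(y, x) \<notin> E" using asym xy(1) by (rule asymD)
    then show "(b, a) \<notin> F" using iff[OF V] xy by simp
  qed
  have circ_F: False
    if p: "3 \<le> length p" "distinct p" and ps: "successively (\<lambda>x y. (x, y) \<in> F \<union> F\<inverse>) p"
      and pl: "(last p, hd p) \<in> F \<union> F\<inverse>" for p
  proof -
    have "p ! i \<in> c ` V" if i: "i < length p" for i
    proof (cases "Suc i < length p")
      case True
      then have "(p ! i, p ! Suc i) \<in> F \<union> F\<inverse>" using ps by (simp add: successively_conv_nth)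
      then show ?thesis using FV by blast
    next
      case False
      then have "i = length p - 1" using i by simp
      moreover have "p \<noteq> []" using p(1) by auto
      ultimately have "p ! i = last p" by (simp add: last_conv_nth)
      then show ?thesis using pl FV by auto
    qed
    then have pV: "set p \<subseteq> c ` V" by (auto simp: in_set_conv_nth)
    define q where "q = map (inv_into V c) p"
    have pq: "p = map c q"
      using pV by (auto simp: q_def f_inv_into_f subset_eq intro!: nth_equalityI)
    have qV: "set q \<subseteq> V" using pV by (auto simp: q_def subset_eq intro: inv_into_into)
    have "q \<noteq> []" using p pq by auto
    have "(q ! i, q ! Suc i) \<in> E \<union> E\<inverse>" if i: "Suc i < length q" for i
    proof -
      have "(c (q ! i), c (q ! Suc i)) \<in> F \<union> F\<inverse>"
        using ps i unfolding pq by (simp add: successively_conv_nth)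
      moreover have "q ! i \<in> V" "q ! Suc i \<in> V" using qV i by (auto simp: subset_eq)
      ultimately show ?thesis using iff' by simp
    qed
    then have "successively (\<lambda>x y. (x, y) \<in> E \<union> E\<inverse>) q" by (simp add: successively_conv_nth)
    moreover have "(last q, hd q) \<in> E \<union> E\<inverse>"
    proof -
      have "last q \<in> V" "hd q \<in> V" using \<open>q \<noteq> []\<close> qV by auto
      moreover have "(c (last q), c (hd q)) \<in> F \<union> F\<inverse>"
        using pl \<open>q \<noteq> []\<close> unfolding pq by (simp add: last_map hd_map)
      ultimately show ?thesis using iff' by simp
    qed
    moreover have "3 \<le> length q" "distinct q" using p by (auto simp: pq distinct_map)
    ultimately show False using circ by blast
  qed
  show ?thesis
    unfolding F_def[symmetric] directed_tree_def
    using ne FV conn_F asym_F circ_F by blast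
qed

theorem FA_fixed_vertex:
  fixes G :: "('a, 'b) monoid_scheme" and V :: "'v set"
  assumes FA: "FA G" and act: "acts_on_tree G V E \<phi>"
  shows "\<exists>v\<in>V. \<forall>g \<in> carrier G. \<phi> g v = v"
proof -
  note A = acts_on_treeD[OF act]
  interpret group G by (rule A(1))
  have EV: "E \<subseteq> V \<times> V" and ne: "V \<noteq> {}"
    and conn: "\<And>x y. x \<in> V \<Longrightarrow> y \<in> V \<Longrightarrow> (x, y) \<in> (E \<union> E\<inverse>)\<^sup>*"
    using A(2) by (auto simp: directed_tree_def)
  obtain v where v: "v \<in> V" using ne by blast
  have "\<exists>n f. f 0 = v \<and> f n = \<phi> g v \<and> (\<forall>i<n. (f i, f (Suc i)) \<in> E \<union> E\<inverse>)"
    if "g \<in> carrier G" for g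
    using conn[OF v A(3)[OF that v]] by (simp only: rtrancl_is_UN_relpow UN_iff relpow_fun_conv) blast
  then obtain n f where f0: "\<And>g. g \<in> carrier G \<Longrightarrow> f g (0::nat) = v"
    and fn: "\<And>g. g \<in> carrier G \<Longrightarrow> f g (n g) = \<phi> g v"
    and fs: "\<And>g i. g \<in> carrier G \<Longrightarrow> i < n g \<Longrightarrow> (f g i, f g (Suc i)) \<in> E \<union> E\<inverse>"
    by metis
  define p where "p g i = f g (min i (n g))" for g i
  have pV: "p g i \<in> V" if g: "g \<in> carrier G" for g i
  proof -
    have "j \<le> n g \<Longrightarrow> f g j \<in> V" for j
    proof (cases j)
      case 0 then show ?thesis using f0 g v by simp
    next
      case (Suc k)
      assume "j \<le> n g"
      then have "(f g k, f g j) \<in> E \<union> E\<inverse>" using fs[OF g, of k] Suc by simp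
      then show ?thesis using EV by blast
    qed
    then show ?thesis by (simp add: p_def)
  qed
  have ps: "p g i = p g (Suc i) \<or> (p g i, p g (Suc i)) \<in> E \<union> E\<inverse>" if "g \<in> carrier G" for g i
    using fs[OF that, of i] by (auto simp: p_def min_def not_less_eq_eq le_Suc_eq)
  define X where "X = carrier G \<times> carrier G \<times> (UNIV :: nat set)"
  define q where "q = (\<lambda>(h, g, i). \<phi> h (p g i))"
  define U where "U = q ` X"
  have qU: "\<phi> h (p g i) \<in> U" if "h \<in> carrier G" "g \<in> carrier G" for h g i
    using that by (auto simp: U_def X_def q_def intro!: rev_image_eqI[of "(h, g, i)"])
  have UV: "U \<subseteq> V" using A(3) pV by (auto simp: U_def X_def q_def)
  have UE: thesis
    if "x \<in> U" "\<And>h k i. \<lbrakk>h \<in> carrier G; k \<in> carrier G; x = \<phi> h (p k i)\<rbrakk> \<Longrightarrow> thesis" for x thesis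
    using that(1) that(2) by (auto simp: U_def X_def q_def)
  have inv: "\<phi> g x \<in> U" if gx: "g \<in> carrier G" "x \<in> U" for g x
  proof -
    obtain h k i where x: "h \<in> carrier G" "k \<in> carrier G" "x = \<phi> h (p k i)"
      by (rule UE[OF gx(2)])
    then have "\<phi> g x = \<phi> (g \<otimes>\<^bsub>G\<^esub> h) (p k i)" using A(5) gx pV by simp
    then show ?thesis using qU gx x by simp
  qed
  define F where "F = E \<inter> U \<times> U"
  have path: "(\<phi> h v, \<phi> h (p g i)) \<in> (F \<union> F\<inverse>)\<^sup>*"
    if h: "h \<in> carrier G" and g: "g \<in> carrier G" for h g i
  proof (induction i)
    case 0 then show ?case using f0 g by (simp add: p_def)
  next
    case (Suc i)
    have "\<phi> h (p g i) = \<phi> h (p g (Suc i)) \<or> (\<phi> h (p g i), \<phi> h (p g (Suc i))) \<in> F \<union> F\<inverse>"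
      using ps[OF g, of i] A(6)[OF h] qU[OF h g] by (auto simp: F_def)
    then show ?case using Suc by (metis rtrancl.rtrancl_into_rtrancl)
  qed
  have conU: "(v, x) \<in> (F \<union> F\<inverse>)\<^sup>*" if xU: "x \<in> U" for x
  proof -
    obtain h k i where x: "h \<in> carrier G" "k \<in> carrier G" "x = \<phi> h (p k i)"
      by (rule UE[OF xU])
    have "p h (n h) = \<phi> h v" using fn x by (simp add: p_def)
    then have "(v, \<phi> h v) \<in> (F \<union> F\<inverse>)\<^sup>*"
      using path[OF one_closed x(1), of "n h"] A(4) v A(3)[OF x(1) v] by simp
    then show ?thesis using path[OF x(1,2), of i] x(3) by (metis rtrancl_trans)
  qed
  have Une: "U \<noteq> {}" using qU[OF one_closed one_closed] by blast
  have tU: "directed_tree U F"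
    unfolding F_def
    by (rule directed_tree_subtree[OF A(2) Une UV, of v]) (use conU in \<open>simp add: F_def\<close>)
  define c where "c = inv_into X q"
  have qc: "q (c x) = x" if "x \<in> U" for x
    using that by (simp add: c_def U_def f_inv_into_f)
  have injc: "inj_on c U" by (metis inj_onI qc)
  define \<psi> where "\<psi> g = (\<lambda>y\<in>c ` U. c (\<phi> g (q y)))" for g
  have \<psi>: "\<psi> g (c x) = c (\<phi> g x)" if "x \<in> U" for g x
    using that qc by (simp add: \<psi>_def)
  have "acts_on_tree G (c ` U) (map_prod c c ` F) \<psi>"
  proof (rule acts_on_treeI)
    show "group G" by (rule A(1))
    show "directed_tree (c ` U) (map_prod c c ` F)"
      by (rule directed_tree_image[OF tU injc])
    show "\<psi> g \<in> extensional (c ` U)" for g by (simp add: \<psi>_def)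
    show "\<psi> g y \<in> c ` U" if "g \<in> carrier G" "y \<in> c ` U" for g y
      using that inv \<psi> by auto
    show "\<psi> \<one>\<^bsub>G\<^esub> y = y" if "y \<in> c ` U" for y
      using that \<psi> A(4) UV by auto
    show "\<psi> (g \<otimes>\<^bsub>G\<^esub> h) y = \<psi> g (\<psi> h y)"
      if gh: "g \<in> carrier G" "h \<in> carrier G" and y: "y \<in> c ` U" for g h y
    proof -
      obtain x where x: "x \<in> U" "y = c x" using y by blast
      then have "x \<in> V" using UV by blast
      then show ?thesis using x gh \<psi> inv A(5) by simp
    qed
    show "(\<psi> g a, \<psi> g b) \<in> map_prod c c ` F"
      if g: "g \<in> carrier G" and ab: "(a, b) \<in> map_prod c c ` F" for g a b
    proof -
      obtain x y where xy: "(x, y) \<in> F" "a = c x" "b = c y" using ab by auto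
      then have U: "x \<in> U" "y \<in> U" by (auto simp: F_def)
      have "(\<phi> g x, \<phi> g y) \<in> F" using xy U A(6)[OF g] inv[OF g] by (simp add: F_def)
      then show ?thesis using xy U \<psi> by (auto intro: rev_image_eqI)
    qed
  qed
  then obtain y where y: "y \<in> c ` U" "\<forall>g \<in> carrier G. \<psi> g y = y"
    using FA unfolding FA_def by blast
  then obtain x where x: "x \<in> U" "y = c x" by blast
  have "\<phi> g x = x" if "g \<in> carrier G" for g
    using y x \<psi> injc inv[OF that x(1)] that by (metis inj_onD)
  then show ?thesis using x UV by blast
qed

end

theory Submission
  imports Defs Complex_Main
begin

text \<open>
  If \<open>m s t = \<infinity>\<close> for some \<open>s, t \<in> T\<close>, then \<open>\<langle>T\<rangle>\<close> is the amalgam of \<open>\<langle>T - {s}\<rangle>\<close> and \<open>\<langle>T - {t}\<rangle>\<close>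
  along \<open>\<langle>T - {s, t}\<rangle>\<close>, and it acts on the Bass--Serre tree whose vertices are the cosets of the
  two factors. A subgroup with FA fixes a vertex, so it is conjugate into a factor; by induction on
  \<open>T\<close> it is conjugate into some \<open>\<langle>B\<rangle>\<close> with \<open>B\<close> complete. Conversely, if \<open>A\<close> is complete and
  finite, then in an action of \<open>\<langle>A\<rangle>\<close> on a tree the fixed subtrees of any two generators meet,
  since the generators span a finite dihedral group, and the Helly property of subtrees gives a
  global fixed vertex. The same trees show that \<open>\<langle>A\<rangle> \<subseteq> k\<langle>B\<rangle>k\<inverse>\<close> with \<open>A\<close> maximal complete forces
  \<open>A = B\<close> and \<open>k \<in> \<langle>A\<rangle>\<close>. That the coset graph is a tree rests on the exchange condition, which is
  obtained from the action of the Coxeter group on its reflections, and on the infinite order of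
  \<open>s t\<close>, which is read off the geometric representation.
\<close>

section \<open>Directed trees\<close>

text \<open>A presentation bounds orders only from above. To see that words represent different
  elements one needs a set on which the relators act trivially; this is why both the parity action
  on reflections and the geometric representation appear. Infinite order is then used in one form
  only: no element has both \<open>s\<close> and \<open>t\<close> as right descents when
  \<open>m s t\<close> is infinite. No amalgamated product is constructed and no normal form theorem
  is assumed. The coset graph is built inside \<open>W\<close>, and each vertex is weighted by the
  least length in its coset; exchange controls how this length changes along an edge, and that
  excludes circuits. Finite generation makes \<open>S\<close> finite, as required by the inductions
  on \<open>T\<close>, by the Helly argument and by the choice of maximal complete sets. In an
  infinite group a subgroup may be properly contained in one of its conjugates, so
  \<open>A = B\<close> alone would not give maximality. The conclusion that the conjugator lies in
  \<open><A>\<close> closes this gap.\<close>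

lemma rtrancl_imp_simple_path:
  assumes "(a, b) \<in> Q\<^sup>*"
  shows "\<exists>p. p \<noteq> [] \<and> distinct p \<and> hd p = a \<and> last p = b \<and> successively (\<lambda>x y. (x, y) \<in> Q) p"
  using assms
proof (induction rule: converse_rtrancl_induct)
  case base
  show ?case by (rule exI[of _ "[b]"]) simp
next
  case (step y z)
  then obtain p where p: "p \<noteq> []" "distinct p" "hd p = z" "last p = b"
    "successively (\<lambda>x y. (x, y) \<in> Q) p" by blast
  show ?case
  proof (cases "y \<in> set p")
    case True
    then obtain us vs where "p = us @ y # vs" by (auto simp: in_set_conv_decomp)
    then show ?thesis using p by (intro exI[of _ "y # vs"]) (auto simp: successively_append_iff)
  next
    case False
    then show ?thesis using p step.hyps
      by (intro exI[of _ "y # p"]) (auto simp: successively_Cons)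
  qed
qed

text \<open>A vertex of greatest height on a circuit would have two distinct neighbours on it, both
  strictly lower because \<open>ne\<close> excludes ties, against \<open>uniq\<close>. Acyclicity
  thus becomes a local condition.\<close>

lemma directed_treeI_height:
  fixes h :: "'v \<Rightarrow> nat"
  assumes "V \<noteq> {}" "E \<subseteq> V \<times> V" "\<And>x. x \<in> V \<Longrightarrow> (r, x) \<in> (E \<union> E\<inverse>)\<^sup>*" "asym E"
    and ne: "\<And>x y. (x, y) \<in> E \<Longrightarrow> h x \<noteq> h y"
    and uniq: "\<And>v y z. \<lbrakk>(v, y) \<in> E \<union> E\<inverse>; (v, z) \<in> E \<union> E\<inverse>; h y < h v; h z < h v\<rbrakk> \<Longrightarrow> y = z"
  shows "directed_tree V E"
proof -
  let ?R = "E \<union> E\<inverse>"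
  have "sym (?R\<^sup>*)" by (intro sym_rtrancl sym_Un_converse)
  then have conn: "\<forall>x\<in>V. \<forall>y\<in>V. (x, y) \<in> ?R\<^sup>*"
    using assms(3) by (meson rtrancl_trans symD)
  have False if p: "3 \<le> length p" "distinct p" "successively (\<lambda>x y. (x, y) \<in> ?R) p"
    "(last p, hd p) \<in> ?R" for p
  proof -
    define n where "n = length p"
    have n: "3 \<le> n" "p \<noteq> []" using p by (auto simp: n_def)
    have step: "(p ! i, p ! (Suc i mod n)) \<in> ?R" if "i < n" for i
    proof (cases "Suc i < n")
      case True
      then show ?thesis using p(3) by (simp add: successively_conv_nth n_def)
    next
      case False
      then have i: "i = n - 1" "Suc i = n" using that by auto
      then show ?thesis using p(4) n by (simp add: hd_conv_nth last_conv_nth n_def)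
    qed
    have "finite (h ` set p)" "h ` set p \<noteq> {}" using n by auto
    then obtain v where v: "v \<in> set p" "h v = Max (h ` set p)"
      by (metis Max_in imageE)
    then obtain i where i: "i < n" "p ! i = v" by (auto simp: in_set_conv_nth n_def)
    \<comment> \<open>\<open>j\<close> and \<open>k\<close> are the cyclic predecessor and successor
      of \<open>i\<close>; they differ because a circuit has at least three vertices.\<close>
    define j where "j = (if i = 0 then n - 1 else i - 1)"
    define k where "k = Suc i mod n"
    have jn: "j < n" "Suc j mod n = i" using i n by (auto simp: j_def)
    have kn: "k < n" using n by (simp add: k_def)
    have jk: "j \<noteq> k" using i n
      by (cases "Suc i = n") (auto simp: j_def k_def)
    have le: "h (p ! l) \<le> h v" if "l < n" for l
      using v(2) that by (simp add: n_def)
    have neR: "h x \<noteq> h y" if "(x, y) \<in> ?R" for x y using that ne by fastforce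
    have a: "(v, p ! k) \<in> ?R" using step[OF i(1)] i by (simp add: k_def)
    have b: "(v, p ! j) \<in> ?R" using step[OF jn(1)] jn i by auto
    have "p ! j = p ! k"
      using uniq[OF b a] le[OF jn(1)] le[OF kn] neR[OF a] neR[OF b] by force
    then show False using jk p(2) jn kn by (simp add: nth_eq_iff_index_eq n_def)
  qed
  then show ?thesis using assms conn unfolding directed_tree_def by blast
qed

section \<open>Distance, branches and subtrees\<close>

locale dtree =
  fixes V :: "'v set" and E :: "('v \<times> 'v) set"
  assumes tree: "directed_tree V E"
begin

definition R :: "('v \<times> 'v) set" where "R = E \<union> E\<inverse>"

definition d :: "'v \<Rightarrow> 'v \<Rightarrow> nat" where "d x y = (LEAST n. (x, y) \<in> R ^^ n)"

text \<open>On the vertices other than \<open>x\<close> its classes are the branches of the tree at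
  \<open>x\<close>. Comparing branches replaces the handling of geodesics as lists.\<close>

definition avoid :: "'v \<Rightarrow> ('v \<times> 'v) set" where "avoid x = (R \<inter> (- {x}) \<times> (- {x}))\<^sup>*"

text \<open>For distinct vertices this is the first step of the geodesic from \<open>x\<close> to
  \<open>y\<close>; by \<open>nx_unique\<close> the choice is no choice at all.\<close>

definition nx :: "'v \<Rightarrow> 'v \<Rightarrow> 'v" where "nx x y = (SOME n. (x, n) \<in> R \<and> d n y < d x y)"

text \<open>The nonempty ones are the subtrees: iterating \<open>nx\<close> runs through the whole
  geodesic. In this form stability under intersection is immediate.\<close>

definition convex :: "'v set \<Rightarrow> bool" where
  "convex C \<longleftrightarrow> C \<subseteq> V \<and> (\<forall>x\<in>C. \<forall>y\<in>C. x \<noteq> y \<longrightarrow> nx x y \<in> C)"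

lemma R_sym: "(x, y) \<in> R \<Longrightarrow> (y, x) \<in> R" by (auto simp: R_def)

lemma R_V: "(x, y) \<in> R \<Longrightarrow> x \<in> V \<and> y \<in> V"
  using tree by (auto simp: R_def directed_tree_def)

lemma asym_E: "(x, y) \<in> E \<Longrightarrow> (y, x) \<notin> E"
  using tree by (auto simp: directed_tree_def dest: asymD)

lemma R_irrefl: "(x, y) \<in> R \<Longrightarrow> x \<noteq> y"
  using asym_E by (auto simp: R_def)

lemma no_circuit:
  "\<lbrakk>3 \<le> length p; distinct p; successively (\<lambda>x y. (x, y) \<in> R) p; (last p, hd p) \<in> R\<rbrakk> \<Longrightarrow> False"
  using tree unfolding directed_tree_def R_def by blast

lemma d_path: assumes "x \<in> V" "y \<in> V" shows "(x, y) \<in> R ^^ d x y"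
proof -
  have "(x, y) \<in> R\<^sup>*" using assms tree unfolding directed_tree_def R_def by blast
  then show ?thesis unfolding d_def by (metis LeastI rtrancl_imp_relpow)
qed

lemma d_le: "(x, y) \<in> R ^^ n \<Longrightarrow> d x y \<le> n"
  unfolding d_def by (rule Least_le)

lemma relpow_R_sym: "(x, y) \<in> R ^^ n \<Longrightarrow> (y, x) \<in> R ^^ n"
proof (induction n arbitrary: y)
  case (Suc n)
  then obtain z where z: "(x, z) \<in> R ^^ n" "(z, y) \<in> R" by auto
  then show ?case using Suc.IH R_sym by (meson relpow_Suc_I2)
qed auto

lemma d_sym: "\<lbrakk>x \<in> V; y \<in> V\<rbrakk> \<Longrightarrow> d x y = d y x"
  by (meson d_le d_path relpow_R_sym antisym)

lemma d_refl [simp]: "d x x = 0"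
  using d_le[of x x 0] by simp

lemma d_0: "\<lbrakk>x \<in> V; y \<in> V; d x y = 0\<rbrakk> \<Longrightarrow> x = y"
  using d_path by fastforce

lemma d_triangle: "\<lbrakk>x \<in> V; y \<in> V; z \<in> V\<rbrakk> \<Longrightarrow> d x z \<le> d x y + d y z"
  by (meson d_le d_path relpow_trans)

lemma d_R: assumes "(x, y) \<in> R" shows "d x y = 1"
proof -
  have "d x y \<noteq> 0" using d_0 R_V R_irrefl assms by blast
  then show ?thesis using d_le[of x y 1] assms by simp
qed

lemma d_1_R: "\<lbrakk>x \<in> V; y \<in> V; d x y = 1\<rbrakk> \<Longrightarrow> (x, y) \<in> R"
  using d_path[of x y] by simp

lemma nx:
  assumes "x \<in> V" "y \<in> V" "x \<noteq> y"
  shows "(x, nx x y) \<in> R" "d (nx x y) y < d x y" "nx x y \<in> V" "d x y = Suc (d (nx x y) y)"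
proof -
  obtain n where n: "d x y = Suc n" using d_0 assms not0_implies_Suc by blast
  then obtain z where z: "(x, z) \<in> R" "(z, y) \<in> R ^^ n"
    using d_path[OF assms(1,2)] by (metis relpow_Suc_D2)
  then have "(x, z) \<in> R \<and> d z y < d x y" using d_le[OF z(2)] n by simp
  then have *: "(x, nx x y) \<in> R \<and> d (nx x y) y < d x y"
    unfolding nx_def by (rule someI)
  then show 1: "(x, nx x y) \<in> R" "d (nx x y) y < d x y" by auto
  show 2: "nx x y \<in> V" using R_V 1 by blast
  show "d x y = Suc (d (nx x y) y)"
    using d_triangle[OF assms(1) 2 assms(2)] d_R[OF 1(1)] 1(2) by simp
qed

lemma avoid_refl [simp]: "(y, y) \<in> avoid x" by (simp add: avoid_def)

lemma avoid_trans: "\<lbrakk>(y, z) \<in> avoid x; (z, w) \<in> avoid x\<rbrakk> \<Longrightarrow> (y, w) \<in> avoid x"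
  unfolding avoid_def by (rule rtrancl_trans)

lemma avoid_sym: assumes "(y, z) \<in> avoid x" shows "(z, y) \<in> avoid x"
proof -
  have "sym ((R \<inter> (- {x}) \<times> (- {x}))\<^sup>*)"
    by (intro sym_rtrancl symI) (auto intro: R_sym)
  then show ?thesis using assms unfolding avoid_def by (rule symD)
qed

lemma avoid_step: "\<lbrakk>(y, z) \<in> R; y \<noteq> x; z \<noteq> x\<rbrakk> \<Longrightarrow> (y, z) \<in> avoid x"
  unfolding avoid_def by blast

text \<open>A simple path joining two neighbours of \<open>x\<close> off \<open>x\<close> closes up
  through \<open>x\<close> to a circuit. This is the one use of \<open>no_circuit\<close>.\<close>

lemma avoid_neighbours_eq:
  assumes n: "(x, n1) \<in> R" "(x, n2) \<in> R" and a: "(n1, n2) \<in> avoid x"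
  shows "n1 = n2"
proof (rule ccontr)
  assume neq: "n1 \<noteq> n2"
  obtain p where p: "p \<noteq> []" "distinct p" "hd p = n1" "last p = n2"
    "successively (\<lambda>y z. (y, z) \<in> R \<inter> (- {x}) \<times> (- {x})) p"
    using rtrancl_imp_simple_path[OF a[unfolded avoid_def]] by blast
  obtain b q where q: "p = n1 # b # q"
    using p neq by (metis last_ConsL list.collapse)
  \<comment> \<open>The chain condition speaks of edges only; since \<open>p\<close> has at least
    two vertices, each of them lies on an edge that avoids \<open>x\<close>.\<close>
  have "x \<notin> set p"
  proof
    assume "x \<in> set p"
    then obtain i where i: "i < length p" "p ! i = x" by (auto simp: in_set_conv_nth)
    show False
    proof (cases "Suc i < length p")
      case True
      then show False using p(5) i by (simp add: successively_conv_nth)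
    next
      case False
      then have "Suc (i - 1) < length p" "Suc (i - 1) = i" using i q by auto
      then have "(p ! (i - 1), p ! i) \<in> R \<inter> (- {x}) \<times> (- {x})"
        using p(5) unfolding successively_conv_nth by metis
      then show False using i by simp
    qed
  qed
  moreover have "successively (\<lambda>y z. (y, z) \<in> R) p"
    by (rule successively_mono[OF p(5)]) auto
  ultimately show False
    using no_circuit[of "x # p"] p n q R_sym by (auto simp: successively_Cons)
qed

text \<open>Along the geodesic from \<open>z\<close> the distance to \<open>y\<close> drops strictly
  below \<open>d x y\<close>, so the geodesic cannot run into \<open>x\<close>.\<close>

lemma avoid_toward:
  "\<lbrakk>x \<in> V; y \<in> V; z \<in> V; z \<noteq> x; d z y \<le> d x y\<rbrakk> \<Longrightarrow> (z, y) \<in> avoid x"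
proof (induction "d z y" arbitrary: z rule: less_induct)
  case less
  show ?case
  proof (cases "z = y")
    case False
    note n = nx[OF less.prems(3,2) False]
    have "nx z y \<noteq> x" using n less.prems by auto
    moreover from this have "(nx z y, y) \<in> avoid x" using n less by auto
    ultimately show ?thesis using avoid_trans avoid_step n(1) less.prems(4) by blast
  qed simp
qed

lemma nx_avoid: "\<lbrakk>x \<in> V; y \<in> V; x \<noteq> y\<rbrakk> \<Longrightarrow> (nx x y, y) \<in> avoid x"
  using avoid_toward nx R_irrefl by (metis less_imp_le)

text \<open>A neighbour no farther from \<open>y\<close> than \<open>x\<close> lies in the branch of
  \<open>y\<close>, and each branch contains only one neighbour of \<open>x\<close>. The weak
  inequality lets the lemma exclude triangles as well.\<close>

lemma nx_unique:
  assumes "x \<in> V" "y \<in> V" "x \<noteq> y" "(x, n) \<in> R" "d n y \<le> d x y"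
  shows "n = nx x y"
proof -
  have "(n, y) \<in> avoid x" using avoid_toward R_V R_irrefl assms by metis
  then show ?thesis
    using avoid_neighbours_eq nx_avoid nx(1) assms avoid_sym avoid_trans by meson
qed

lemma avoid_nx_eq:
  assumes "x \<in> V" "y \<in> V" "z \<in> V" "x \<noteq> y" "x \<noteq> z" "(y, z) \<in> avoid x"
  shows "nx x y = nx x z"
  using avoid_neighbours_eq nx_avoid nx(1) assms avoid_sym avoid_trans by meson

text \<open>Geodesics between points of \<open>C\<close> stay in \<open>C\<close>; hence a convex
  set missing \<open>x\<close> lies in a single branch at \<open>x\<close>.\<close>

lemma convex_avoid:
  "\<lbrakk>convex C; x \<notin> C; y \<in> C; a \<in> C\<rbrakk> \<Longrightarrow> (y, a) \<in> avoid x"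
proof (induction "d y a" arbitrary: y rule: less_induct)
  case less
  show ?case
  proof (cases "y = a")
    case False
    have V: "y \<in> V" "a \<in> V" and nC: "nx y a \<in> C"
      using less.prems False by (auto simp: convex_def)
    note n = nx[OF V False]
    have "(nx y a, a) \<in> avoid x" using less n nC by blast
    moreover have "(y, nx y a) \<in> avoid x" using avoid_step n nC less.prems by metis
    ultimately show ?thesis using avoid_trans by blast
  qed simp
qed

lemma convex_Int: "\<lbrakk>convex C; convex D\<rbrakk> \<Longrightarrow> convex (C \<inter> D)"
  by (auto simp: convex_def)

text \<open>Take \<open>x\<close> in \<open>A\<close> and \<open>B\<close> nearest to a point
  \<open>y\<close> of \<open>A\<close> and \<open>C\<close>. If \<open>C\<close> misses
  \<open>x\<close>, it lies in one branch at \<open>x\<close>, so the first steps towards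
  \<open>y\<close> (inside \<open>A\<close>) and towards \<open>a\<close> (inside \<open>B\<close>)
  coincide and lead to a nearer common point.\<close>

lemma helly_three:
  assumes A: "convex A" and B: "convex B" and C: "convex C"
    and ne: "A \<inter> B \<noteq> {}" "A \<inter> C \<noteq> {}" "B \<inter> C \<noteq> {}"
  shows "A \<inter> B \<inter> C \<noteq> {}"
proof -
  obtain y where y: "y \<in> A" "y \<in> C" using ne by blast
  obtain a where a: "a \<in> B" "a \<in> C" using ne by blast
  have "\<exists>x. x \<in> A \<inter> B" using ne by blast
  then obtain x where x: "x \<in> A \<inter> B" and min: "\<And>z. z \<in> A \<inter> B \<Longrightarrow> d x y \<le> d z y"
    using ex_has_least_nat[of "\<lambda>x. x \<in> A \<inter> B" _ "\<lambda>x. d x y"] by blast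
  have "x \<in> C"
  proof (rule ccontr)
    assume xC: "x \<notin> C"
    have V: "x \<in> V" "y \<in> V" "a \<in> V" using x y a A B by (auto simp: convex_def)
    have neq: "x \<noteq> y" "x \<noteq> a" using xC y a by auto
    have "nx x y = nx x a" using avoid_nx_eq V neq convex_avoid[OF C xC] y a by blast
    moreover have "nx x y \<in> A" using A x y neq by (auto simp: convex_def)
    moreover have "nx x a \<in> B" using B x a neq by (auto simp: convex_def)
    ultimately have "nx x y \<in> A \<inter> B" by simp
    then show False using min nx(2)[OF V(1,2) neq(1)] by fastforce
  qed
  then show ?thesis using x by blast
qed

text \<open>Intersecting all sets with \<open>F k\<close> preserves the hypotheses, by
  \<open>helly_three\<close>. The case \<open>i = j\<close> of the second hypothesis says that each
  set is nonempty.\<close>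

lemma helly:
  assumes "finite I"
  shows "\<lbrakk>\<And>i. i \<in> I \<Longrightarrow> convex (F i); \<And>i j. i \<in> I \<Longrightarrow> j \<in> I \<Longrightarrow> F i \<inter> F j \<noteq> {}\<rbrakk>
    \<Longrightarrow> \<exists>v\<in>V. \<forall>i\<in>I. v \<in> F i"
  using assms
proof (induction I arbitrary: F rule: finite_induct)
  case empty
  then show ?case using tree by (auto simp: directed_tree_def)
next
  case (insert k I)
  show ?case
  proof (cases "I = {}")
    case True
    then show ?thesis using insert.prems[of k] by (auto simp: convex_def)
  next
    case False
    have "\<exists>v\<in>V. \<forall>i\<in>I. v \<in> F i \<inter> F k"
    proof (rule insert.IH)
      show "convex (F i \<inter> F k)" if "i \<in> I" for i using that insert.prems convex_Int by blast
      show "F i \<inter> F k \<inter> (F j \<inter> F k) \<noteq> {}" if "i \<in> I" "j \<in> I" for i j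
        using helly_three[of "F i" "F j" "F k"] insert.prems that by blast
    qed
    then show ?thesis using False by blast
  qed
qed

text \<open>Strictness in the triangle inequality means that the geodesic misses \<open>x\<close>.
  The slack survives each step, since a step towards \<open>a\<close> changes the distance to
  \<open>x\<close> by at most one.\<close>

lemma avoid_of_d_less:
  "\<lbrakk>x \<in> V; y \<in> V; a \<in> V; y \<noteq> x; d y a < d y x + d x a\<rbrakk> \<Longrightarrow> (y, a) \<in> avoid x"
proof (induction "d y a" arbitrary: y rule: less_induct)
  case less
  show ?case
  proof (cases "y = a")
    case False
    note n = nx[OF less.prems(2,3) False]
    have "d y x \<le> 1 + d (nx y a) x"
      using d_triangle[OF less.prems(2) n(3) less.prems(1)] d_R[OF n(1)] by simp
    then have "d (nx y a) a < d (nx y a) x + d x a" using n(4) less.prems by simp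
    moreover from this have "nx y a \<noteq> x" by auto
    ultimately show ?thesis using less n avoid_step avoid_trans by metis
  qed simp
qed

lemma d_add:
  assumes "x \<in> V" "y \<in> V" "a \<in> V" "x \<noteq> y" "x \<noteq> a" "nx x y \<noteq> nx x a"
  shows "d y a = d y x + d x a"
  using avoid_of_d_less[of x y a] avoid_nx_eq[of x y a] d_triangle[of y x a] assms
  by (metis le_neq_implies_less)

text \<open>The fixed vertex is a centre of \<open>X\<close>. Centres are pairwise at distance at most one, so a
  centre that is moved is the end of an inverted edge.\<close>

lemma finite_invariant_fixed_vertex:
  assumes X: "finite X" "X \<noteq> {}" "X \<subseteq> V"
    and \<Phi>: "\<And>\<alpha>. \<alpha> \<in> \<Phi> \<Longrightarrow> \<alpha> ` X = X" "\<And>\<alpha> x. \<alpha> \<in> \<Phi> \<Longrightarrow> x \<in> V \<Longrightarrow> \<alpha> x \<in> V"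
      "\<And>\<alpha> x y. \<alpha> \<in> \<Phi> \<Longrightarrow> x \<in> V \<Longrightarrow> y \<in> V \<Longrightarrow> d (\<alpha> x) (\<alpha> y) = d x y"
      "\<And>\<alpha> x y. \<alpha> \<in> \<Phi> \<Longrightarrow> (x, y) \<in> E \<Longrightarrow> (\<alpha> x, \<alpha> y) \<in> E"
  shows "\<exists>v\<in>V. \<forall>\<alpha>\<in>\<Phi>. \<alpha> v = v"
proof -
  define e where "e x = Max (d x ` X)" for x
  have e_ge: "d x y \<le> e x" if "y \<in> X" for x y using that X by (simp add: e_def)
  have e_inv: "e (\<alpha> x) = e x" if "\<alpha> \<in> \<Phi>" "x \<in> V" for \<alpha> x
  proof -
    have "d (\<alpha> x) ` X = d (\<alpha> x) ` \<alpha> ` X" using \<Phi>(1) that by simp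
    also have "\<dots> = (\<lambda>y. d (\<alpha> x) (\<alpha> y)) ` X" by (simp only: image_image)
    also have "\<dots> = d x ` X" by (rule image_cong) (use \<Phi>(3) that X(3) in auto)
    finally show ?thesis by (simp add: e_def)
  qed
  have "\<exists>x. x \<in> V" using X by blast
  then obtain x where x: "x \<in> V" and min: "\<And>z. z \<in> V \<Longrightarrow> e x \<le> e z"
    using ex_has_least_nat[of "\<lambda>x. x \<in> V" _ e] by blast
  \<comment> \<open>If \<open>z\<close> were two or more steps away, one step from \<open>x\<close>
    towards \<open>z\<close> would lower the eccentricity \<open>e\<close>: points in the branch of
    \<open>z\<close> get nearer, and every other \<open>y\<close> satisfies
    \<open>d z y = d z x + d x y\<close>, which leaves room for one step.\<close>
  have close: "d x z \<le> 1" if z: "z \<in> V" "e z = e x" for z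
  proof (rule ccontr)
    assume far: "\<not> d x z \<le> 1"
    then have neq: "x \<noteq> z" by auto
    note n = nx[OF x z(1) neq]
    have "d (nx x z) y < e x" if y: "y \<in> X" for y
    proof -
      have yV: "y \<in> V" using X y by blast
      consider "y = x" | "y \<noteq> x" "nx x y = nx x z" | "y \<noteq> x" "nx x y \<noteq> nx x z" by blast
      then show ?thesis
      proof cases
        case 1
        have "d (nx x z) y = 1" using 1 d_R[OF R_sym[OF n(1)]] by simp
        also have "\<dots> < d z x" using far d_sym x z by simp
        finally show ?thesis using e_ge[OF y, of z] z 1 by simp
      next
        case 2
        then show ?thesis using nx(2)[OF x yV] e_ge[OF y, of x] by fastforce
      next
        case 3
        have "d z y = d z x + d x y" using d_add[OF x z(1) yV neq] 3 by force
        moreover have "d (nx x z) y \<le> 1 + d x y"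
          using d_triangle[OF n(3) x yV] d_R[OF R_sym[OF n(1)]] by simp
        ultimately show ?thesis using e_ge[OF y, of z] z far d_sym[OF x z(1)] by simp
      qed
    qed
    then have "e (nx x z) < e x" using X by (simp add: e_def)
    then show False using min[OF n(3)] by simp
  qed
  have "\<alpha> x = x" if \<alpha>: "\<alpha> \<in> \<Phi>" for \<alpha>
  proof (rule ccontr)
    assume ne: "\<alpha> x \<noteq> x"
    let ?y = "\<alpha> x" and ?z = "\<alpha> (\<alpha> x)"
    have V: "?y \<in> V" "?z \<in> V" using \<Phi>(2) \<alpha> x by auto
    have dxy: "d x ?y = 1"
      using close[OF V(1) e_inv[OF \<alpha> x]] d_0[OF x V(1)] ne by force
    then have dyz: "d ?y ?z = 1" using \<Phi>(3)[OF \<alpha> x V(1)] by simp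
    have "d x ?z \<le> 1" using close V e_inv \<alpha> x by simp
    \<comment> \<open>Otherwise \<open>x\<close>, \<open>?y\<close> and \<open>?z\<close> would form
      a triangle.\<close>
    moreover have "d x ?z \<noteq> 1"
    proof
      assume a: "d x ?z = 1"
      then have xz: "x \<noteq> ?z" by auto
      have "?y = nx x ?z"
        using nx_unique[OF x V(2) xz] d_1_R[OF x V(1) dxy] a dyz by simp
      then show False using nx(2)[OF x V(2) xz] a dyz by simp
    qed
    ultimately have z: "?z = x" using d_0[OF x V(2)] by simp
    have "(x, ?y) \<in> R" using d_1_R[OF x V(1) dxy] .
    then consider "(x, ?y) \<in> E" | "(?y, x) \<in> E" by (auto simp: R_def)
    then show False using \<Phi>(4)[OF \<alpha>] z asym_E by metis
  qed
  then show ?thesis using x by blast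
qed

end

section \<open>Fixed vertices of group actions on trees\<close>

locale tree_action = dtree V E for V :: "'v set" and E +
  fixes G :: "('a, 'b) monoid_scheme" and \<phi>
  assumes act: "acts_on_tree G V E \<phi>"
begin

sublocale G: group G using acts_on_treeD(1)[OF act] .

lemmas closed = acts_on_treeD(3)[OF act]
  and one = acts_on_treeD(4)[OF act]
  and mult = acts_on_treeD(5)[OF act]
  and edge = acts_on_treeD(6)[OF act]

lemma R_act: "\<lbrakk>g \<in> carrier G; (x, y) \<in> R\<rbrakk> \<Longrightarrow> (\<phi> g x, \<phi> g y) \<in> R"
  using edge by (auto simp: R_def)

lemma inv_act: "\<lbrakk>g \<in> carrier G; x \<in> V\<rbrakk> \<Longrightarrow> \<phi> (inv\<^bsub>G\<^esub> g) (\<phi> g x) = x"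
  using mult[of "inv\<^bsub>G\<^esub> g" g x] one by simp

lemma d_act_le: assumes "g \<in> carrier G" "x \<in> V" "y \<in> V" shows "d (\<phi> g x) (\<phi> g y) \<le> d x y"
proof -
  have "(\<phi> g x, \<phi> g y) \<in> R ^^ n" if "(x, y) \<in> R ^^ n" for n
    using that
  proof (induction n arbitrary: y)
    case (Suc n)
    then obtain z where z: "(x, z) \<in> R ^^ n" "(z, y) \<in> R" by auto
    show ?case using Suc.IH[OF z(1)] R_act[OF assms(1) z(2)] by (rule relpow_Suc_I)
  qed simp
  then show ?thesis using d_path[OF assms(2,3)] d_le by blast
qed

lemma d_act: assumes "g \<in> carrier G" "x \<in> V" "y \<in> V" shows "d (\<phi> g x) (\<phi> g y) = d x y"
  using d_act_le[of "inv\<^bsub>G\<^esub> g" "\<phi> g x" "\<phi> g y"] d_act_le[OF assms] inv_act assms closed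
  by (metis G.inv_closed le_antisym)

text \<open>An isometry fixing both ends carries the first step to a first step, which is unique.
  Besides making fixed sets convex, this provides a fixed neighbour whenever two vertices are
  fixed.\<close>

lemma nx_fixed:
  assumes g: "g \<in> carrier G" and V: "x \<in> V" "y \<in> V" "x \<noteq> y" and "\<phi> g x = x" "\<phi> g y = y"
  shows "\<phi> g (nx x y) = nx x y"
proof (rule nx_unique[OF V])
  show "(x, \<phi> g (nx x y)) \<in> R" using R_act[OF g nx(1)[OF V]] assms by simp
  show "d (\<phi> g (nx x y)) y \<le> d x y" using d_act[OF g nx(3)[OF V] V(2)] nx(4)[OF V] assms by simp
qed

lemma convex_fixed: "g \<in> carrier G \<Longrightarrow> convex {v \<in> V. \<phi> g v = v}"
  using nx_fixed nx(3) by (auto simp: convex_def)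

text \<open>The orbit of any vertex is finite and invariant.\<close>

lemma finite_subgroup_fixed_vertex:
  assumes H: "subgroup H G" "finite H"
  shows "\<exists>v\<in>V. \<forall>g\<in>H. \<phi> g v = v"
proof -
  obtain v where v: "v \<in> V" using tree by (auto simp: directed_tree_def)
  have Hc: "h \<in> carrier G" if "h \<in> H" for h using that H subgroup.mem_carrier by metis
  define X where "X = (\<lambda>h. \<phi> h v) ` H"
  have XV: "X \<subseteq> V" using Hc closed v by (auto simp: X_def)
  have sub: "\<phi> g ` X \<subseteq> X" if "g \<in> H" for g
  proof -
    have "\<phi> g (\<phi> h v) \<in> X" if "h \<in> H" for h
      using mult[OF Hc[OF \<open>g \<in> H\<close>] Hc[OF that] v] subgroup.m_closed[OF H(1) \<open>g \<in> H\<close> that]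
      by (metis X_def imageI)
    then show ?thesis by (auto simp: X_def)
  qed
  have "\<exists>v\<in>V. \<forall>\<alpha>\<in>\<phi> ` H. \<alpha> v = v"
  proof (rule finite_invariant_fixed_vertex[of X])
    show "finite X" "X \<noteq> {}" "X \<subseteq> V"
      using H XV subgroup.one_closed[OF H(1)] by (auto simp: X_def)
    show "\<alpha> ` X = X" if \<alpha>: "\<alpha> \<in> \<phi> ` H" for \<alpha>
    proof -
      obtain g where g: "g \<in> H" "\<alpha> = \<phi> g" using \<alpha> by blast
      have "x \<in> \<phi> g ` X" if x: "x \<in> X" for x
      proof -
        have i: "inv\<^bsub>G\<^esub> g \<in> H" using subgroup.m_inv_closed[OF H(1) g(1)] .
        have "\<phi> g (\<phi> (inv\<^bsub>G\<^esub> g) x) = x"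
          using inv_act[OF Hc[OF i], of x] Hc[OF g(1)] XV x by auto
        then show ?thesis using sub[OF i] x by (metis image_eqI image_subset_iff)
      qed
      then show ?thesis using sub g by blast
    qed
  qed (use Hc closed d_act edge in auto)
  then show ?thesis by blast
qed

end

lemma tree_actionI: "acts_on_tree G V E \<phi> \<Longrightarrow> tree_action V E G \<phi>"
  using acts_on_treeD(2) by (auto simp: tree_action_def tree_action_axioms_def dtree_def)

section \<open>Coxeter systems: words, length and the exchange condition\<close>

text \<open>Multiplication by \<open>2 * sin x\<close> makes the sum telescope, and \<open>n\<close>
  steps of \<open>2 * x\<close> are a full turn. This is what verifies the dihedral relations in the
  geometric representation.\<close>

lemma sum_sin_arith_progression:
  fixes x y :: real
  assumes "real n * x = pi" "sin x \<noteq> 0"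
  shows "(\<Sum>j<n. sin (2 * real j * x + y)) = 0"
proof -
  have "2 * sin x * (\<Sum>j<k. sin (2 * real j * x + y)) = cos (y - x) - cos (2 * real k * x + y - x)"
    for k
  proof (induction k)
    case (Suc k)
    have "2 * sin x * sin (2 * real k * x + y) =
        cos (2 * real k * x + y - x) - cos (2 * real k * x + y + x)"
      by (simp add: cos_add cos_diff algebra_simps)
    moreover have "2 * real (Suc k) * x + y - x = 2 * real k * x + y + x"
      by (simp add: algebra_simps)
    ultimately show ?case using Suc by (simp only: sum.lessThan_Suc distrib_left)
  qed simp
  from this[of n] have "2 * sin x * (\<Sum>j<n. sin (2 * real j * x + y)) =
      cos (y - x) - cos (2 * (real n * x) + (y - x))" by (simp add: algebra_simps)
  also have "\<dots> = 0" by (simp add: assms(1) cos_add)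
  finally show ?thesis using assms(2) by simp
qed

locale coxeter =
  fixes W :: "('a, 'b) monoid_scheme" (structure) and S :: "'a set" and m :: "'a \<Rightarrow> 'a \<Rightarrow> enat"
  assumes cox: "coxeter_system W S m"
begin

sublocale group W
  using cox by (simp add: coxeter_system_def has_presentation_def)

lemma S_carrier: "S \<subseteq> carrier W"
  and generate_S: "generate W S = carrier W"
  and presentation: "w \<in> lists (S \<times> UNIV) \<Longrightarrow>
        word_eval W w = \<one> \<longleftrightarrow> word_equiv S (coxeter_relators S m) w []"
  and relators_lists: "coxeter_relators S m \<subseteq> lists (S \<times> UNIV)"
  using cox by (auto simp: coxeter_system_def has_presentation_def)

lemma S_closed [simp, intro]: "s \<in> S \<Longrightarrow> s \<in> carrier W"
  using S_carrier by blast

lemma m_self [simp]: "s \<in> S \<Longrightarrow> m s s = 1"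
  and m_sym: "s \<in> S \<Longrightarrow> t \<in> S \<Longrightarrow> m s t = m t s"
  and m_eq_1: "s \<in> S \<Longrightarrow> t \<in> S \<Longrightarrow> m s t = 1 \<longleftrightarrow> s = t"
  and m_ge_1: "s \<in> S \<Longrightarrow> t \<in> S \<Longrightarrow> 1 \<le> m s t"
  using cox by (auto simp: coxeter_system_def coxeter_matrix_def)

definition ev :: "'a list \<Rightarrow> 'a" where "ev ws = foldr (\<otimes>) ws \<one>"

lemma ev_Nil [simp]: "ev [] = \<one>" and ev_Cons [simp]: "ev (s # ws) = s \<otimes> ev ws"
  by (simp_all add: ev_def)

lemma ev_closed [simp, intro]: "set ws \<subseteq> S \<Longrightarrow> ev ws \<in> carrier W"
  by (induction ws) auto

lemma ev_append: "\<lbrakk>set us \<subseteq> S; set vs \<subseteq> S\<rbrakk> \<Longrightarrow> ev (us @ vs) = ev us \<otimes> ev vs"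
  by (induction us) (auto simp: m_assoc)

lemma word_eval_concat_replicate:
  "\<lbrakk>s \<in> S; t \<in> S\<rbrakk> \<Longrightarrow> word_eval W (concat (replicate n [(s, True), (t, True)])) = (s \<otimes> t) [^] n"
proof (induction n)
  case (Suc n)
  then have "word_eval W (concat (replicate (Suc n) [(s, True), (t, True)])) = s \<otimes> t \<otimes> (s \<otimes> t) [^] n"
    by (simp add: m_assoc)
  also have "\<dots> = (s \<otimes> t) [^] Suc n" using Suc.prems by (intro nat_pow_Suc2[symmetric]) auto
  finally show ?case .
qed simp

lemma relation: assumes "s \<in> S" "t \<in> S" "m s t = enat n" shows "(s \<otimes> t) [^] n = \<one>"
proof -
  let ?r = "concat (replicate n [(s, True), (t, True)])"
  have r: "?r \<in> coxeter_relators S m" using assms by (auto simp: coxeter_relators_def)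
  then have "word_equiv S (coxeter_relators S m) ([] @ ?r @ []) ([] @ [])"
    by (rule word_equiv.relator)
  moreover have "?r \<in> lists (S \<times> UNIV)" using r relators_lists by blast
  ultimately have "word_eval W ?r = \<one>" using presentation[of ?r] by simp
  then show ?thesis using word_eval_concat_replicate[OF assms(1,2)] by simp
qed

lemma S_square [simp]: "s \<in> S \<Longrightarrow> s \<otimes> s = \<one>"
  using relation[of s s 1] by (simp add: one_enat_def)

lemma S_inv [simp]: "s \<in> S \<Longrightarrow> inv s = s"
  by (simp add: inv_equality)

lemma S_cancel [simp]: "\<lbrakk>s \<in> S; x \<in> carrier W\<rbrakk> \<Longrightarrow> s \<otimes> (s \<otimes> x) = x"
  "\<lbrakk>s \<in> S; x \<in> carrier W\<rbrakk> \<Longrightarrow> x \<otimes> s \<otimes> s = x"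
  by (metis S_square S_closed m_assoc l_one) (metis S_square S_closed m_assoc r_one)

lemma ev_rev: "set ws \<subseteq> S \<Longrightarrow> ev (rev ws) = inv (ev ws)"
  by (induction ws) (auto simp: ev_append inv_mult_group)

lemma word_eval_map: "word_eval W (map (\<lambda>s. (s, True)) ws) = ev ws"
  by (induction ws) auto

section \<open>Extending maps attached to the generators to an action of the group\<close>

context
  fixes h :: "'a \<Rightarrow> 'x \<Rightarrow> 'x"
  assumes h: "\<And>s t n. \<lbrakk>s \<in> S; t \<in> S; m s t = enat n\<rbrakk> \<Longrightarrow> (h s \<circ> h t) ^^ n = id"
begin

lemma action_square: "s \<in> S \<Longrightarrow> h s (h s x) = x"
  using h[of s s 1] by (simp add: one_enat_def fun_eq_iff)

lemma action_word_equiv: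
  "word_equiv S (coxeter_relators S m) v w \<Longrightarrow> foldr (\<lambda>l. h (fst l)) v = foldr (\<lambda>l. h (fst l)) w"
proof (induction rule: word_equiv.induct)
  case (cancel s u b v)
  then show ?case by (auto simp: action_square)
next
  case (relator r u v)
  then obtain s t n where r: "s \<in> S" "t \<in> S" "m s t = enat n"
    "r = concat (replicate n [(s, True), (t, True)])"
    by (auto simp: coxeter_relators_def)
  have "foldr (\<lambda>l. h (fst l)) (concat (replicate k [(s, True), (t, True)])) = (h s \<circ> h t) ^^ k" for k
    by (induction k) (auto simp: fun_eq_iff)
  then have "foldr (\<lambda>l. h (fst l)) r = id" using h r by simp
  then show ?case by (simp add: fun_eq_iff)
qed simp_all

text \<open>The universal property of the presentation: maps satisfying the Coxeter relations depend
  only on the element that a word represents. It is applied to \<open>refl_act\<close> and to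
  \<open>sigma\<close>.\<close>

lemma action_unique:
  assumes "set ws \<subseteq> S" "set vs \<subseteq> S" "ev ws = ev vs"
  shows "foldr h ws = foldr h vs"
proof -
  let ?w = "map (\<lambda>s. (s, True)) (ws @ rev vs)"
  have rv: "set (rev vs) \<subseteq> S" using assms by auto
  have "word_eval W ?w = \<one>"
    using assms rv by (simp only: word_eval_map ev_append ev_rev r_inv ev_closed)
  moreover have "?w \<in> lists (S \<times> UNIV)" using assms by auto
  ultimately have "word_equiv S (coxeter_relators S m) ?w []"
    using presentation by blast
  then have 1: "foldr h (ws @ rev vs) = id"
    using action_word_equiv[of ?w "[]"] by (simp add: fun_eq_iff foldr_map comp_def)
  have 2: "foldr h (rev vs) (foldr h vs x) = x" for x
    using assms(2) by (induction vs arbitrary: x) (auto simp: action_square)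
  show ?thesis
  proof
    fix x
    show "foldr h ws x = foldr h vs x" using fun_cong[OF 1, of "foldr h vs x"] 2 by simp
  qed
qed

end

subsection \<open>The reflection cocycle\<close>

text \<open>The Boolean records the parity of the number of times the reflection is met by the
  word.\<close>

definition refl_act :: "'a \<Rightarrow> 'a \<times> bool \<Rightarrow> 'a \<times> bool" where
  "refl_act s = (\<lambda>(r, b). if s \<in> S \<and> r \<in> carrier W then (s \<otimes> r \<otimes> s, b \<noteq> (r = s)) else (r, b))"

lemma refl_act_eq:
  "\<lbrakk>s \<in> S; r \<in> carrier W\<rbrakk> \<Longrightarrow> refl_act s (r, b) = (s \<otimes> r \<otimes> s, b \<noteq> (r = s))"
  by (simp add: refl_act_def)

text \<open>While the \<open>2 * n\<close> letters act, the bit flips at those indices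
  \<open>i\<close> for which \<open>r\<close> equals \<open>(t s)^i t\<close>. This condition has
  period \<open>n\<close> in \<open>i\<close>, so every flip in the first half recurs in the second
  and the parity is even.\<close>

lemma refl_act_relation:
  assumes s: "s \<in> S" and t: "t \<in> S" and m: "m s t = enat n"
  shows "(refl_act s \<circ> refl_act t) ^^ n = id"
proof
  fix x :: "'a \<times> bool"
  obtain r b where x: "x = (r, b)" by fastforce
  show "((refl_act s \<circ> refl_act t) ^^ n) x = id x"
  proof (cases "r \<in> carrier W")
    case False
    have "((refl_act s \<circ> refl_act t) ^^ k) (r, b) = (r, b)" for k
      using False by (induction k) (auto simp: refl_act_def)
    then show ?thesis using x by simp
  next
    case r: True
    define u v where "u = s \<otimes> t" and "v = t \<otimes> s"
    have [simp]: "s \<in> carrier W" "t \<in> carrier W" "u \<in> carrier W" "v \<in> carrier W"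
      using s t by (auto simp: u_def v_def)
    have v: "v = inv u" using s t by (simp add: u_def v_def inv_mult_group)
    have pow: "u [^] k \<otimes> v [^] k = \<one>" "v [^] k \<otimes> u [^] k = \<one>" for k :: nat
      by (simp_all add: v nat_pow_inv)
    have tu: "t \<otimes> u [^] k = v [^] k \<otimes> t" for k :: nat
    proof (induction k)
      case (Suc k)
      have "t \<otimes> u [^] Suc k = (t \<otimes> u [^] k) \<otimes> u" by (simp add: m_assoc)
      also have "\<dots> = v [^] k \<otimes> (t \<otimes> u)" by (simp add: Suc m_assoc)
      also have "t \<otimes> u = v \<otimes> t" by (simp add: u_def v_def m_assoc)
      finally show ?case by (simp add: m_assoc)
    qed simp
    have conj_eq: "u [^] k \<otimes> r \<otimes> v [^] k = y \<longleftrightarrow> r = v [^] k \<otimes> y \<otimes> u [^] k"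
      if y: "y \<in> carrier W" for k :: nat and y
    proof
      assume "u [^] k \<otimes> r \<otimes> v [^] k = y"
      then have "v [^] k \<otimes> y \<otimes> u [^] k = v [^] k \<otimes> (u [^] k \<otimes> r \<otimes> v [^] k) \<otimes> u [^] k" by simp
      also have "\<dots> = (v [^] k \<otimes> u [^] k) \<otimes> r \<otimes> (v [^] k \<otimes> u [^] k)"
        using r y by (simp add: m_assoc)
      finally show "r = v [^] k \<otimes> y \<otimes> u [^] k" using pow r by simp
    next
      assume "r = v [^] k \<otimes> y \<otimes> u [^] k"
      then have "u [^] k \<otimes> r \<otimes> v [^] k = (u [^] k \<otimes> v [^] k) \<otimes> y \<otimes> (u [^] k \<otimes> v [^] k)"
        using y by (simp add: m_assoc)
      then show "u [^] k \<otimes> r \<otimes> v [^] k = y" using pow y by simp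
    qed
    \<comment> \<open>\<open>c i\<close> is one when letter number \<open>i\<close> flips the bit,
      with the current reflection conjugated back to \<open>r\<close>. Even indices belong to
      \<open>t\<close> and odd ones to \<open>s\<close>.\<close>
    define c where "c i = (if r = v [^] i \<otimes> t then 1 else 0 :: nat)" for i :: nat
    have hit_t: "u [^] k \<otimes> r \<otimes> v [^] k = t \<longleftrightarrow> c (2 * k) = 1" for k
    proof -
      have "v [^] k \<otimes> t \<otimes> u [^] k = v [^] (2 * k) \<otimes> t"
        by (simp add: m_assoc tu mult_2 nat_pow_mult[symmetric])
      then show ?thesis by (simp add: conj_eq c_def)
    qed
    have hit_s: "t \<otimes> (u [^] k \<otimes> r \<otimes> v [^] k) \<otimes> t = s \<longleftrightarrow> c (2 * k + 1) = 1" for k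
    proof -
      have "t \<otimes> (u [^] k \<otimes> r \<otimes> v [^] k) \<otimes> t = s \<longleftrightarrow> u [^] k \<otimes> r \<otimes> v [^] k = t \<otimes> s \<otimes> t"
      proof
        assume "t \<otimes> (u [^] k \<otimes> r \<otimes> v [^] k) \<otimes> t = s"
        from this[symmetric] show "u [^] k \<otimes> r \<otimes> v [^] k = t \<otimes> s \<otimes> t"
          using r t by (simp add: m_assoc)
      qed (use r t in \<open>simp add: m_assoc\<close>)
      moreover have "v [^] k \<otimes> (t \<otimes> s \<otimes> t) \<otimes> u [^] k = v [^] (2 * k + 1) \<otimes> t"
      proof -
        have "v [^] k \<otimes> (t \<otimes> s \<otimes> t) \<otimes> u [^] k = v [^] k \<otimes> v \<otimes> (t \<otimes> u [^] k)"
          by (simp add: v_def m_assoc)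
        also have "\<dots> = v [^] Suc k \<otimes> v [^] k \<otimes> t" by (simp add: tu m_assoc)
        also have "\<dots> = v [^] (Suc k + k) \<otimes> t" by (subst nat_pow_mult) simp_all
        finally show ?thesis by (simp add: mult_2)
      qed
      ultimately show ?thesis by (simp add: conj_eq c_def)
    qed
    have iter: "((refl_act s \<circ> refl_act t) ^^ k) (r, b) =
        (u [^] k \<otimes> r \<otimes> v [^] k, b \<noteq> odd (\<Sum>i<2 * k. c i))" for k
    proof (induction k)
      case (Suc k)
      have c01: "c i = 0 \<or> c i = 1" for i by (simp add: c_def)
      have "s \<otimes> (t \<otimes> (u [^] k \<otimes> r \<otimes> v [^] k) \<otimes> t) \<otimes> s = u \<otimes> u [^] k \<otimes> r \<otimes> (v [^] k \<otimes> v)"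
        using r by (simp add: u_def v_def m_assoc)
      also have "\<dots> = u [^] Suc k \<otimes> r \<otimes> v [^] Suc k"
        using nat_pow_Suc2[of u k] by simp
      finally have conj: "s \<otimes> (t \<otimes> (u [^] k \<otimes> r \<otimes> v [^] k) \<otimes> t) \<otimes> s = u [^] Suc k \<otimes> r \<otimes> v [^] Suc k" .
      define x where "x = u [^] k \<otimes> r \<otimes> v [^] k"
      have x: "x \<in> carrier W" "t \<otimes> x \<otimes> t \<in> carrier W" using r by (simp_all add: x_def)
      have "((refl_act s \<circ> refl_act t) ^^ Suc k) (r, b) =
          refl_act s (refl_act t (x, b \<noteq> odd (\<Sum>i<2 * k. c i)))"
        by (simp only: funpow.simps comp_apply Suc x_def)
      also have "\<dots> = (s \<otimes> (t \<otimes> x \<otimes> t) \<otimes> s,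
          ((b \<noteq> odd (\<Sum>i<2 * k. c i)) \<noteq> (x = t)) \<noteq> (t \<otimes> x \<otimes> t = s))"
        by (simp only: refl_act_eq[OF t x(1)] refl_act_eq[OF s x(2)])
      also have "((b \<noteq> odd (\<Sum>i<2 * k. c i)) \<noteq> (x = t)) \<noteq> (t \<otimes> x \<otimes> t = s) \<longleftrightarrow>
          b \<noteq> odd (\<Sum>i<2 * Suc k. c i)"
        unfolding x_def hit_t hit_s using c01[of "2 * k"] c01[of "2 * k + 1"] by auto
      finally show ?case unfolding x_def conj .
    qed (use r in simp)
    have un: "u [^] n = \<one>" using relation[OF s t m] by (simp add: u_def)
    then have vn: "v [^] n = \<one>" using pow(2)[of n] by simp
    have per: "c (i + n) = c i" for i
      by (simp add: c_def nat_pow_mult[symmetric] vn)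
    have "(\<Sum>i<2 * n. c i) = (\<Sum>i<n. c i) + (\<Sum>i<n. c (i + n))"
      using sum.atLeastLessThan_concat[of 0 n "n + n" c] sum.shift_bounds_nat_ivl[of c 0 n n]
      by (simp add: mult_2 lessThan_atLeast0)
    then have "even (\<Sum>i<2 * n. c i)" using per by simp
    then show ?thesis using iter[of n] x r un vn by simp
  qed
qed

definition meets :: "'a list \<Rightarrow> 'a \<Rightarrow> bool" where
  "meets ws r = snd (foldr refl_act ws (r, False))"

lemma meets_unique:
  "\<lbrakk>set ws \<subseteq> S; set vs \<subseteq> S; ev ws = ev vs\<rbrakk> \<Longrightarrow> meets ws r = meets vs r"
  unfolding meets_def using action_unique[of refl_act ws vs] refl_act_relation by metis

lemma fst_refl_act:
  "\<lbrakk>set ws \<subseteq> S; r \<in> carrier W\<rbrakk> \<Longrightarrow> fst (foldr refl_act ws (r, b)) = ev ws \<otimes> r \<otimes> inv (ev ws)"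
  by (induction ws) (auto simp: refl_act_def case_prod_beta inv_mult_group m_assoc)

lemma snd_refl_act: "snd (foldr refl_act ws (r, b)) = (b \<noteq> meets ws r) \<and>
    fst (foldr refl_act ws (r, b)) = fst (foldr refl_act ws (r, False))"
  unfolding meets_def by (induction ws) (auto simp: refl_act_def case_prod_beta)

text \<open>\<open>foldr\<close> applies the last letter first; \<open>s\<close> fixes the
  reflection \<open>s\<close> and flips its bit.\<close>

lemma meets_snoc: "\<lbrakk>set ws \<subseteq> S; s \<in> S\<rbrakk> \<Longrightarrow> meets (ws @ [s]) s \<longleftrightarrow> \<not> meets ws s"
  using snd_refl_act[of ws s True] unfolding meets_def by (simp add: refl_act_def)

text \<open>A flip at the letter \<open>s\<close> says that \<open>r\<close> is \<open>s\<close>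
  conjugated by the suffix \<open>vs\<close>, so multiplying by \<open>r\<close> on the right
  cancels that letter.\<close>

lemma meets_imp_deletion:
  "\<lbrakk>set ws \<subseteq> S; r \<in> carrier W; meets ws r\<rbrakk> \<Longrightarrow>
    \<exists>us s vs. ws = us @ s # vs \<and> ev ws \<otimes> r = ev (us @ vs)"
proof (induction ws)
  case Nil
  then show ?case by (simp add: meets_def)
next
  case (Cons a ws)
  then have a: "a \<in> S" "set ws \<subseteq> S" by auto
  define r' where "r' = ev ws \<otimes> r \<otimes> inv (ev ws)"
  have r': "r' \<in> carrier W" using a Cons.prems by (simp add: r'_def)
  have "foldr refl_act ws (r, False) = (r', meets ws r)"
    using fst_refl_act[OF a(2) Cons.prems(2), of False] unfolding meets_def r'_def
    by (metis prod.collapse)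
  then have "meets (a # ws) r = snd (refl_act a (r', meets ws r))"
    by (simp add: meets_def[of "a # ws"])
  then have "meets (a # ws) r = (meets ws r \<noteq> (r' = a))"
    by (simp add: refl_act_eq a r')
  then consider "meets ws r" | "r' = a" using Cons.prems by blast
  then show ?case
  proof cases
    case 1
    then obtain us s vs where "ws = us @ s # vs" "ev ws \<otimes> r = ev (us @ vs)"
      using Cons a by blast
    then show ?thesis using a Cons.prems
      by (intro exI[of _ "a # us"] exI[of _ s] exI[of _ vs]) (simp add: m_assoc)
  next
    case 2
    then have "ev ws \<otimes> r = a \<otimes> ev ws"
      using a Cons.prems by (auto simp: r'_def inv_solve_right')
    then show ?thesis using a Cons.prems
      by (intro exI[of _ "[]"] exI[of _ a] exI[of _ ws]) (simp add: m_assoc)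
  qed
qed

subsection \<open>Length\<close>

definition len :: "'a \<Rightarrow> nat" where
  "len x = (LEAST n. \<exists>ws. set ws \<subseteq> S \<and> length ws = n \<and> ev ws = x)"

lemma generate_eq_ev: assumes "A \<subseteq> S" shows "generate W A = ev ` {ws. set ws \<subseteq> A}"
proof
  show "generate W A \<subseteq> ev ` {ws. set ws \<subseteq> A}"
  proof
    fix x assume "x \<in> generate W A"
    then show "x \<in> ev ` {ws. set ws \<subseteq> A}"
    proof (induction rule: generate.induct)
      case one
      show ?case by (rule image_eqI[of _ _ "[]"]) auto
    next
      case (incl h)
      then show ?case using assms by (intro image_eqI[of _ _ "[h]"]) auto
    next
      case (inv h)
      then show ?case using assms by (intro image_eqI[of _ _ "[h]"]) auto
    next
      case (eng h1 h2)
      then obtain u v where uv: "set u \<subseteq> A" "set v \<subseteq> A" "h1 = ev u" "h2 = ev v" by auto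
      then have "h1 \<otimes> h2 = ev (u @ v)" using assms ev_append[of u v] by auto
      then show ?case using uv by (intro image_eqI[of _ _ "u @ v"]) auto
    qed
  qed
  have "ev ws \<in> generate W A" if "set ws \<subseteq> A" for ws
    using that by (induction ws) (auto intro: generate.one generate.incl generate.eng)
  then show "ev ` {ws. set ws \<subseteq> A} \<subseteq> generate W A" by blast
qed

lemma reduced_word: assumes "x \<in> carrier W"
  obtains ws where "set ws \<subseteq> S" "ev ws = x" "length ws = len x"
proof -
  have "x \<in> ev ` {ws. set ws \<subseteq> S}" using assms generate_eq_ev[of S] generate_S by simp
  then obtain vs where "set vs \<subseteq> S" "ev vs = x" by blast
  then have "\<exists>n ws. set ws \<subseteq> S \<and> length ws = n \<and> ev ws = x" by blast
  from LeastI_ex[OF this] have "\<exists>ws. set ws \<subseteq> S \<and> length ws = len x \<and> ev ws = x"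
    unfolding len_def .
  then show ?thesis using that by blast
qed

lemma len_le: "set ws \<subseteq> S \<Longrightarrow> len (ev ws) \<le> length ws"
  unfolding len_def by (rule Least_le) blast

lemma len_one [simp]: "len \<one> = 0"
  using len_le[of "[]"] by simp

lemma len_0: "\<lbrakk>x \<in> carrier W; len x = 0\<rbrakk> \<Longrightarrow> x = \<one>"
  by (metis ev_Nil length_0_conv reduced_word)

lemma len_snoc_le: assumes "x \<in> carrier W" "s \<in> S" shows "len (x \<otimes> s) \<le> Suc (len x)"
proof -
  obtain ws where w: "set ws \<subseteq> S" "ev ws = x" "length ws = len x"
    using reduced_word assms by blast
  then show ?thesis using len_le[of "ws @ [s]"] assms by (simp add: ev_append)
qed

text \<open>If \<open>ws\<close> misses \<open>s\<close>, then \<open>ws @ [s]\<close> meets it, and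
  so does a reduced word of the product. Deleting a letter there would make \<open>ev ws\<close>
  shorter than the product, against \<open>le\<close>. The word \<open>ws\<close> need not be
  reduced.\<close>

lemma exchange:
  assumes ws: "set ws \<subseteq> S" and s: "s \<in> S" and le: "len (ev ws \<otimes> s) \<le> len (ev ws)"
  shows "\<exists>us r vs. ws = us @ r # vs \<and> ev ws \<otimes> s = ev (us @ vs)"
proof (cases "meets ws s")
  case True
  then show ?thesis using meets_imp_deletion ws s by blast
next
  case False
  have x: "ev ws \<in> carrier W" using ws by simp
  obtain vs where vs: "set vs \<subseteq> S" "ev vs = ev ws \<otimes> s" "length vs = len (ev ws \<otimes> s)"
    using reduced_word[of "ev ws \<otimes> s"] x s by auto
  have "meets vs s = meets (ws @ [s]) s"
    using meets_unique[of vs "ws @ [s]"] ws s vs by (simp add: ev_append)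
  then have "meets vs s" using meets_snoc ws s False by simp
  then obtain us r zs where d: "vs = us @ r # zs" "ev vs \<otimes> s = ev (us @ zs)"
    using meets_imp_deletion vs s by blast
  have "ev ws = ev (us @ zs)" using d vs x s by simp
  then have "len (ev ws) < length vs" using len_le[of "us @ zs"] d vs by simp
  then show ?thesis using le vs by simp
qed

text \<open>Deletion from a reduced word gives a strictly shorter one, so equal lengths are excluded
  without a sign character.\<close>

lemma len_snoc_less_or: assumes x: "x \<in> carrier W" and s: "s \<in> S"
  shows "len (x \<otimes> s) < len x \<or> len (x \<otimes> s) = Suc (len x)"
proof (cases "len (x \<otimes> s) \<le> len x")
  case True
  obtain ws where w: "set ws \<subseteq> S" "ev ws = x" "length ws = len x"
    by (rule reduced_word[OF x])
  then obtain us r vs where "ws = us @ r # vs" "x \<otimes> s = ev (us @ vs)"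
    using exchange[OF w(1) s] True by auto
  then show ?thesis using len_le[of "us @ vs"] w by simp
qed (use len_snoc_le[OF assms] in simp)

lemma len_snoc_less: assumes "x \<in> carrier W" "s \<in> S" "len (x \<otimes> s) < len x"
  shows "len x = Suc (len (x \<otimes> s))"
  using len_snoc_less_or[of "x \<otimes> s" s] assms by simp

subsection \<open>The geometric representation\<close>

text \<open>The canonical bilinear form on the simple roots; \<open>-1\<close> is the limit of
  \<open>- cos (pi / n)\<close>.\<close>

definition form :: "'a \<Rightarrow> 'a \<Rightarrow> real" where
  "form s r = (case m s r of enat n \<Rightarrow> - cos (pi / real n) | \<infinity> \<Rightarrow> -1)"

text \<open>This is the contragredient action, on functions on the set of simple roots, so that \<open>S\<close> need
  not be finite.\<close>

definition sigma :: "'a \<Rightarrow> ('a \<Rightarrow> real) \<Rightarrow> 'a \<Rightarrow> real" where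
  "sigma s f = (\<lambda>r. f r - 2 * form s r * f s)"

lemma form_self: "s \<in> S \<Longrightarrow> form s s = 1"
  by (simp add: form_def one_enat_def)

lemma form_sym: "\<lbrakk>s \<in> S; t \<in> S\<rbrakk> \<Longrightarrow> form s t = form t s"
  by (simp add: form_def m_sym)

text \<open>Each \<open>sigma\<close> subtracts a multiple of one row of \<open>form\<close>. The
  multipliers, read off at \<open>t\<close> and \<open>s\<close> in turn, are the odd and even terms
  of one sequence with a three-term recurrence.\<close>

lemma sigma_iterate:
  fixes x :: "nat \<Rightarrow> real"
  assumes s: "s \<in> S" and t: "t \<in> S"
    and x: "x 0 = - f s" "x 1 = f t" "\<And>i. x (i + 2) = - 2 * form s t * x (i + 1) - x i"
  shows "((sigma s \<circ> sigma t) ^^ k) f =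
      (\<lambda>r. f r - 2 * form t r * (\<Sum>j<k. x (2 * j + 1)) - 2 * form s r * (\<Sum>j<k. x (2 * j + 2))) \<and>
    ((sigma s \<circ> sigma t) ^^ k) f t = x (2 * k + 1) \<and> ((sigma s \<circ> sigma t) ^^ k) f s = - x (2 * k)"
proof (induction k)
  case 0
  then show ?case using x by simp
next
  case (Suc k)
  define F where "F = ((sigma s \<circ> sigma t) ^^ k) f"
  have F: "F = (\<lambda>r. f r - 2 * form t r * (\<Sum>j<k. x (2 * j + 1)) -
      2 * form s r * (\<Sum>j<k. x (2 * j + 2)))" "F t = x (2 * k + 1)" "F s = - x (2 * k)"
    using Suc unfolding F_def by blast+
  have step: "((sigma s \<circ> sigma t) ^^ Suc k) f = sigma s (sigma t F)"
    by (simp only: F_def funpow.simps comp_apply)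
  have x2: "x (2 * k + 2) = - 2 * form s t * x (2 * k + 1) - x (2 * k)"
    and x3: "x (2 * k + 3) = - 2 * form s t * x (2 * k + 2) - x (2 * k + 1)"
    using x(3)[of "2 * k"] x(3)[of "2 * k + 1"] by (simp_all add: numeral_eq_Suc)
  have G: "sigma t F s = x (2 * k + 2)"
    using F x2 by (simp add: sigma_def form_sym[OF t s])
  have H: "sigma s (sigma t F) = (\<lambda>r. F r - 2 * form t r * x (2 * k + 1) - 2 * form s r * x (2 * k + 2))"
    by (simp add: sigma_def[of s] G) (simp add: sigma_def F(2))
  have "sigma s (sigma t F) t = x (2 * k + 3)"
    unfolding H using F x3 form_self[OF t] by simp
  moreover have "sigma s (sigma t F) s = - x (2 * k + 2)"
    unfolding H using F x2 form_self[OF s] form_sym[OF t s] by simp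
  moreover have "sigma s (sigma t F) = (\<lambda>r. f r - 2 * form t r * (\<Sum>j<Suc k. x (2 * j + 1)) -
      2 * form s r * (\<Sum>j<Suc k. x (2 * j + 2)))"
    unfolding H by (simp add: F(1) fun_eq_iff algebra_simps)
  ultimately show ?case unfolding step by (simp add: numeral_eq_Suc)
qed

lemma sigma_relation:
  assumes s: "s \<in> S" and t: "t \<in> S" and m: "m s t = enat n"
  shows "(sigma s \<circ> sigma t) ^^ n = id"
proof
  fix f :: "'a \<Rightarrow> real"
  show "((sigma s \<circ> sigma t) ^^ n) f = id f"
  proof (cases "s = t")
    case True
    then have "n = 1" using m s by (simp add: one_enat_def)
    then show ?thesis using True form_self[OF s] by (simp add: sigma_def fun_eq_iff)
  next
    case False
    then have "n \<noteq> 0" "n \<noteq> 1"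
      using m m_ge_1[OF s t] m_eq_1[OF s t] by (auto simp: one_enat_def)
    then have n: "2 \<le> n" by simp
    define \<theta> where "\<theta> = pi / real n"
    have n\<theta>: "real n * \<theta> = pi" using n by (simp add: \<theta>_def)
    have "0 < \<theta>" "\<theta> < pi" using n by (auto simp: \<theta>_def divide_less_eq)
    then have sin: "sin \<theta> \<noteq> 0" using sin_gt_zero by force
    have c: "form s t = - cos \<theta>" using m by (simp add: form_def \<theta>_def)
    \<comment> \<open>The solution of the recurrence with \<open>x 0 = - f s\<close> and
      \<open>x 1 = f t\<close>; the division is legitimate because \<open>n\<close> is at least
      two.\<close>
    define x where "x i = (f t * sin (real i * \<theta>) + f s * sin ((real i - 1) * \<theta>)) / sin \<theta>" for i
    have rec: "sin (y + 2 * \<theta>) = 2 * cos \<theta> * sin (y + \<theta>) - sin y" for y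
    proof -
      have "sin (y + 2 * \<theta>) + sin y = 2 * sin (y + \<theta>) * cos \<theta>"
        by (subst sin_plus_sin) (simp add: algebra_simps add_divide_distrib)
      then show ?thesis by (simp add: algebra_simps)
    qed
    have x_rec: "x (i + 2) = - 2 * form s t * x (i + 1) - x i" for i
    proof -
      have e1: "sin (real (i + 2) * \<theta>) = 2 * cos \<theta> * sin (real (i + 1) * \<theta>) - sin (real i * \<theta>)"
        using rec[of "real i * \<theta>"] by (simp add: algebra_simps)
      have e2: "sin ((real (i + 2) - 1) * \<theta>) =
          2 * cos \<theta> * sin ((real (i + 1) - 1) * \<theta>) - sin ((real i - 1) * \<theta>)"
        using rec[of "(real i - 1) * \<theta>"] by (simp add: algebra_simps)
      show ?thesis
        unfolding x_def c e1 e2 by (simp add: add_divide_distrib diff_divide_distrib algebra_simps)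
    qed
    \<comment> \<open>Every second term is summed, so the angle advances by twice
      \<open>pi / n\<close> and \<open>n\<close> terms make a full turn.\<close>
    have sum0: "(\<Sum>j<n. x (2 * j + k)) = 0" for k
    proof -
      have eq: "real (2 * j + k) * \<theta> = 2 * real j * \<theta> + real k * \<theta>"
        "(real (2 * j + k) - 1) * \<theta> = 2 * real j * \<theta> + (real k - 1) * \<theta>" for j
        by (simp_all add: algebra_simps)
      have "(\<Sum>j<n. x (2 * j + k)) =
          (f t * (\<Sum>j<n. sin (2 * real j * \<theta> + real k * \<theta>)) +
           f s * (\<Sum>j<n. sin (2 * real j * \<theta> + (real k - 1) * \<theta>))) / sin \<theta>"
        by (simp only: x_def eq sum_divide_distrib[symmetric] sum.distrib sum_distrib_left[symmetric])
      then show ?thesis using sum_sin_arith_progression[OF n\<theta> sin] by simp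
    qed
    have "x 0 = - f s" "x 1 = f t" using sin by (simp_all add: x_def)
    then have "((sigma s \<circ> sigma t) ^^ n) f =
      (\<lambda>r. f r - 2 * form t r * (\<Sum>j<n. x (2 * j + 1)) - 2 * form s r * (\<Sum>j<n. x (2 * j + 2)))"
      using sigma_iterate[OF s t, where x = x] x_rec by blast
    then show ?thesis by (simp only: sum0) simp
  qed
qed

section \<open>Alternating words in two generators\<close>

fun alt :: "nat \<Rightarrow> 'a \<Rightarrow> 'a \<Rightarrow> 'a list" where
  "alt 0 a b = []"
| "alt (Suc n) a b = alt n b a @ [a]"

lemma set_alt: "set (alt n a b) \<subseteq> {a, b}"
  by (induction n arbitrary: a b) auto

text \<open>For \<open>form a b = -1\<close> the sum of the values at \<open>a\<close> and
  \<open>b\<close> is invariant, so the two generators act as reflections of a line. The parameter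
  \<open>k\<close> is the position on it and grows by one with each letter.\<close>

lemma sigma_alt:
  assumes "a \<in> S" "b \<in> S" "m a b = \<infinity>" "f a = 2 * k + 1" "f b = 1 - 2 * k"
  shows "foldr sigma (alt n a b) f (if even n then a else b) = 2 * (k + real n) + 1 \<and>
         foldr sigma (alt n a b) f (if even n then b else a) = 1 - 2 * (k + real n)"
  using assms
proof (induction n arbitrary: a b k f)
  case (Suc n)
  have "form a b = -1" using Suc.prems by (simp add: form_def)
  then have "sigma a f b = 2 * (k + 1) + 1" "sigma a f a = 1 - 2 * (k + 1)"
    using Suc.prems form_self by (simp_all add: sigma_def)
  from Suc.IH[OF _ _ _ this] show ?case
    using Suc.prems m_sym[of a b] by (auto simp: algebra_simps split: if_splits)
qed simp

text \<open>Started at the constant function one, the two words move in opposite directions along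
  this line.\<close>

lemma alt_neq:
  assumes s: "s \<in> S" and t: "t \<in> S" and m: "m s t = \<infinity>" and n: "0 < n"
  shows "ev (alt n s t) \<noteq> ev (alt n t s)"
proof
  assume "ev (alt n s t) = ev (alt n t s)"
  then have eq: "foldr sigma (alt n s t) = foldr sigma (alt n t s)"
    using action_unique[of sigma "alt n s t" "alt n t s"] sigma_relation
      set_alt[of n s t] set_alt[of n t s] s t by blast
  have "m t s = \<infinity>" using m m_sym[OF s t] by simp
  then have "foldr sigma (alt n t s) (\<lambda>_. 1) (if even n then s else t) = 1 - 2 * real n"
    using sigma_alt[OF t s, of "\<lambda>_. 1" 0 n] by auto
  moreover have "foldr sigma (alt n s t) (\<lambda>_. 1) (if even n then s else t) = 2 * real n + 1"
    using sigma_alt[OF s t m, of "\<lambda>_. 1" 0 n] by auto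
  ultimately show False using eq n by simp
qed

subsection \<open>Special subgroups and minimal coset representatives\<close>

lemma gen_subgroup: "A \<subseteq> S \<Longrightarrow> subgroup (generate W A) W"
  using generate_is_subgroup S_carrier by (meson order_trans)

lemma gen_closed: "\<lbrakk>A \<subseteq> S; x \<in> generate W A\<rbrakk> \<Longrightarrow> x \<in> carrier W"
  using gen_subgroup subgroup.mem_carrier by metis

lemma gen_mult: "\<lbrakk>x \<in> generate W A; y \<in> generate W A\<rbrakk> \<Longrightarrow> x \<otimes> y \<in> generate W A"
  by (rule generate.eng)

lemma gen_inv: "\<lbrakk>A \<subseteq> S; x \<in> generate W A\<rbrakk> \<Longrightarrow> inv x \<in> generate W A"
  using gen_subgroup subgroup.m_inv_closed by metis

lemma gen_mono: "\<lbrakk>A \<subseteq> B; x \<in> generate W A\<rbrakk> \<Longrightarrow> x \<in> generate W B"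
  using mono_generate by blast

lemma ev_gen: "\<lbrakk>A \<subseteq> S; set ws \<subseteq> A\<rbrakk> \<Longrightarrow> ev ws \<in> generate W A"
  using generate_eq_ev by blast

text \<open>Exchange only removes letters and so stays within \<open>A\<close>. Hence a shortest
  word over \<open>A\<close> is shortest over \<open>S\<close>, and length in \<open><A>\<close>
  agrees with length in \<open>W\<close>.\<close>

lemma minimal_word_reduced:
  "\<lbrakk>A \<subseteq> S; set ws \<subseteq> A; \<And>vs. set vs \<subseteq> A \<Longrightarrow> ev vs = ev ws \<Longrightarrow> length ws \<le> length vs\<rbrakk>
    \<Longrightarrow> len (ev ws) = length ws"
proof (induction ws rule: rev_induct)
  case (snoc s ws)
  have w: "set ws \<subseteq> S" "set ws \<subseteq> A" "s \<in> S" "s \<in> A" using snoc.prems by auto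
  have "length ws \<le> length vs" if "set vs \<subseteq> A" "ev vs = ev ws" for vs
  proof -
    have "set vs \<subseteq> S" using that snoc.prems by blast
    then have "ev (vs @ [s]) = ev (ws @ [s])" using that w by (simp add: ev_append)
    then show ?thesis using snoc.prems(3)[of "vs @ [s]"] that w by simp
  qed
  then have IH: "len (ev ws) = length ws" using snoc.IH snoc.prems(1) w by blast
  have "\<not> len (ev ws \<otimes> s) \<le> len (ev ws)"
  proof
    assume "len (ev ws \<otimes> s) \<le> len (ev ws)"
    then obtain us r vs where d: "ws = us @ r # vs" "ev ws \<otimes> s = ev (us @ vs)"
      using exchange w by blast
    have "ev (ws @ [s]) = ev ws \<otimes> s" using w by (simp add: ev_append)
    then show False using snoc.prems(3)[of "us @ vs"] d w by simp
  qed
  then show ?case using len_snoc_less_or[of "ev ws" s] IH w by (auto simp: ev_append)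
qed simp

lemma gen_reduced_word: assumes "A \<subseteq> S" "x \<in> generate W A"
  obtains ws where "set ws \<subseteq> A" "ev ws = x" "length ws = len x"
proof -
  obtain w where "set w \<subseteq> A \<and> ev w = x" using assms generate_eq_ev[OF assms(1)] by auto
  from ex_has_least_nat[of "\<lambda>ws. set ws \<subseteq> A \<and> ev ws = x" w length, OF this]
  obtain ws where "set ws \<subseteq> A" "ev ws = x"
    "\<And>vs. set vs \<subseteq> A \<Longrightarrow> ev vs = x \<Longrightarrow> length ws \<le> length vs" by blast
  then show ?thesis using minimal_word_reduced[OF assms(1), of ws] that by metis
qed

lemma S_in_gen: assumes "A \<subseteq> S" "s \<in> S" "s \<in> generate W A" shows "s \<in> A"
proof -
  obtain ws where w: "set ws \<subseteq> A" "ev ws = s" "length ws = len s"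
    by (rule gen_reduced_word[OF assms(1,3)])
  have "len s = 1" using len_snoc_less_or[of \<one> s] assms by simp
  then obtain a where "ws = [a]" using w by (metis One_nat_def length_0_conv length_Suc_conv)
  then show ?thesis using w assms by auto
qed

text \<open>Exchange in a reduced word over \<open>A\<close> for the same element shows that
  removing the last letter \<open>s\<close> stays in \<open><A>\<close>. Then \<open>s\<close>
  itself lies in \<open><A>\<close>, hence in \<open>A\<close>.\<close>

lemma reduced_word_in_gen:
  "\<lbrakk>A \<subseteq> S; set ws \<subseteq> S; length ws = len (ev ws); ev ws \<in> generate W A\<rbrakk> \<Longrightarrow> set ws \<subseteq> A"
proof (induction ws rule: rev_induct)
  case (snoc s ws)
  have w: "set ws \<subseteq> S" "s \<in> S" using snoc.prems by auto
  have e: "ev (ws @ [s]) = ev ws \<otimes> s" using w by (simp add: ev_append)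
  define x where "x = ev ws \<otimes> s"
  have x: "x \<in> carrier W" "x \<otimes> s = ev ws" "x \<in> generate W A" "len x = Suc (length ws)"
    using w snoc.prems e by (simp_all add: x_def)
  obtain vs where v: "set vs \<subseteq> A" "ev vs = x" "length vs = len x"
    by (rule gen_reduced_word[OF snoc.prems(1) x(3)])
  have vS: "set vs \<subseteq> S" using v snoc.prems by blast
  have less: "len (x \<otimes> s) \<le> length ws" using len_le[OF w(1)] x by simp
  then obtain us r zs where d: "vs = us @ r # zs" "x \<otimes> s = ev (us @ zs)"
    using exchange[OF vS w(2)] v x by auto
  then have "x \<otimes> s \<in> generate W A" using ev_gen[OF snoc.prems(1), of "us @ zs"] v by simp
  then have "inv x \<otimes> (x \<otimes> s) \<in> generate W A"
    using gen_mult gen_inv[OF snoc.prems(1) x(3)] by blast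
  then have "s \<in> generate W A" using x(1) w by (simp add: m_assoc[symmetric])
  then have "s \<in> A" using S_in_gen snoc.prems w by blast
  moreover have "length ws = len (ev ws)"
    using len_snoc_le[of "ev ws" s] len_le[OF w(1)] w snoc.prems(3) e by simp
  then have "set ws \<subseteq> A"
    using snoc.IH snoc.prems(1) w \<open>x \<otimes> s \<in> generate W A\<close> x(2) by simp
  ultimately show ?case by simp
qed simp

lemma gen_Int:
  assumes "A \<subseteq> S" "B \<subseteq> S" "x \<in> generate W A" "x \<in> generate W B"
  shows "x \<in> generate W (A \<inter> B)"
proof -
  obtain ws where w: "set ws \<subseteq> A" "ev ws = x" "length ws = len x"
    by (rule gen_reduced_word[OF assms(1,3)])
  then have "set ws \<subseteq> B" using reduced_word_in_gen[of B ws] assms by auto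
  then show ?thesis using ev_gen[of "A \<inter> B" ws] w assms by auto
qed

section \<open>Coset representatives of least length\<close>

definition minrep :: "'a \<Rightarrow> 'a set \<Rightarrow> bool" where
  "minrep g A \<longleftrightarrow> (\<forall>a\<in>generate W A. len g \<le> len (g \<otimes> a))"

lemma ex_minrep:
  assumes x: "x \<in> carrier W" and A: "A \<subseteq> S"
  obtains g a where "g \<in> carrier W" "a \<in> generate W A" "x = g \<otimes> a" "minrep g A"
proof -
  from ex_has_least_nat[of "\<lambda>a. a \<in> generate W A" \<one> "\<lambda>a. len (x \<otimes> a)", OF generate.one]
  obtain a where a: "a \<in> generate W A"
    and least: "\<And>b. b \<in> generate W A \<Longrightarrow> len (x \<otimes> a) \<le> len (x \<otimes> b)" by blast
  have ac: "a \<in> carrier W" using gen_closed[OF A a] .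
  show thesis
  proof (rule that[of "x \<otimes> a" "inv a"])
    show "minrep (x \<otimes> a) A"
      using least gen_mult[OF a] gen_closed[OF A] x ac by (simp add: minrep_def m_assoc)
  qed (use x ac gen_inv[OF A a] in \<open>simp_all add: m_assoc\<close>)
qed

text \<open>If appending a letter shortened the product, exchange would delete a letter from the
  reduced word of \<open>g\<close>, against minimality in the coset, or from \<open>ws\<close>,
  against reducedness.\<close>

lemma minrep_len_word:
  "\<lbrakk>g \<in> carrier W; A \<subseteq> S; minrep g A; set ws \<subseteq> A; length ws = len (ev ws)\<rbrakk> \<Longrightarrow>
    len (g \<otimes> ev ws) = len g + length ws"
proof (induction ws rule: rev_induct)
  case (snoc s ws)
  have w: "set ws \<subseteq> S" "s \<in> S" "set ws \<subseteq> A" "s \<in> A" using snoc.prems by auto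
  have e: "ev (ws @ [s]) = ev ws \<otimes> s" using w by (simp add: ev_append)
  have "length ws = len (ev ws)"
    using len_snoc_le[of "ev ws" s] len_le[OF w(1)] w snoc.prems(5) e by simp
  then have IH: "len (g \<otimes> ev ws) = len g + length ws" using snoc w by blast
  obtain gs where g: "set gs \<subseteq> S" "ev gs = g" "length gs = len g"
    by (rule reduced_word[OF snoc.prems(1)])
  have gw: "ev (gs @ ws) = g \<otimes> ev ws" using g w by (simp add: ev_append)
  have c: "g \<in> carrier W" "ev ws \<in> carrier W" "s \<in> carrier W" using snoc.prems w by auto
  have "\<not> len (g \<otimes> ev ws \<otimes> s) \<le> len (g \<otimes> ev ws)"
  proof
    assume "len (g \<otimes> ev ws \<otimes> s) \<le> len (g \<otimes> ev ws)"
    then obtain us r vs where d: "gs @ ws = us @ r # vs" "g \<otimes> ev ws \<otimes> s = ev (us @ vs)"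
      using exchange[of "gs @ ws" s] gw g w by auto
    consider p where "gs = us @ r # p" "vs = p @ ws" | p where "us = gs @ p" "ws = p @ r # vs"
      using d(1) by (auto simp: append_eq_append_conv2 append_eq_Cons_conv Cons_eq_append_conv)
    then show False
    proof cases
      case 1
      \<comment> \<open>The appended letter moved to the left past \<open>ws\<close>:
        \<open>g\<close> times this element of \<open><A>\<close> is represented by the word of
        \<open>g\<close> with one letter deleted.\<close>
      define a where "a = ev ws \<otimes> s \<otimes> inv (ev ws)"
      have p: "set us \<subseteq> S" "set p \<subseteq> S" using 1 g by auto
      then have uc: "ev (us @ p) \<in> carrier W" by (intro ev_closed) auto
      have "ev (us @ vs) = ev (us @ p) \<otimes> ev ws" using 1 p w ev_append[of "us @ p" ws] by simp
      then have "ev (us @ p) = g \<otimes> ev ws \<otimes> s \<otimes> inv (ev ws)"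
        using d(2) uc c by (simp add: m_assoc)
      then have "ev (us @ p) = g \<otimes> a" using c by (simp add: a_def m_assoc)
      moreover have "a \<in> generate W A"
        unfolding a_def using ev_gen[OF snoc.prems(2) w(3)] w(4) gen_inv[OF snoc.prems(2)]
        by (intro gen_mult) (auto intro: generate.incl)
      ultimately have "len g \<le> len (ev (us @ p))" using snoc.prems(3) by (simp add: minrep_def)
      also have "\<dots> \<le> length (us @ p)" using p by (intro len_le) auto
      finally show False using g 1 by simp
    next
      case 2
      have p: "set p \<subseteq> S" "set vs \<subseteq> S" using 2 w by auto
      then have pc: "ev (p @ vs) \<in> carrier W" by (intro ev_closed) auto
      have "ev (us @ vs) = g \<otimes> ev (p @ vs)" using 2 g p ev_append[of gs "p @ vs"] by simp
      then have "g \<otimes> (ev ws \<otimes> s) = g \<otimes> ev (p @ vs)" using d(2) c by (simp add: m_assoc)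
      then have "ev ws \<otimes> s = ev (p @ vs)" using c pc by simp
      then have "len (ev (ws @ [s])) \<le> length (p @ vs)" using e p len_le[of "p @ vs"] by simp
      then show False using snoc.prems(5) 2 by simp
    qed
  qed
  then have "len (g \<otimes> ev ws \<otimes> s) = Suc (len (g \<otimes> ev ws))"
    using len_snoc_less_or[of "g \<otimes> ev ws" s] c w by auto
  then show ?case using IH c by (simp add: e m_assoc)
qed simp

lemma minrep_len:
  assumes "g \<in> carrier W" "A \<subseteq> S" "minrep g A" "a \<in> generate W A"
  shows "len (g \<otimes> a) = len g + len a"
proof -
  obtain ws where w: "set ws \<subseteq> A" "ev ws = a" "length ws = len a"
    by (rule gen_reduced_word[OF assms(2,4)])
  then show ?thesis using minrep_len_word[OF assms(1-3), of ws] by simp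
qed

section \<open>Right descents\<close>

lemma last_descent:
  assumes A: "A \<subseteq> S" and a: "a \<in> generate W A" and "a \<noteq> \<one>"
  obtains r where "r \<in> A" "len (a \<otimes> r) < len a" "a \<otimes> r \<in> generate W A"
proof -
  obtain ws where w: "set ws \<subseteq> A" "ev ws = a" "length ws = len a"
    by (rule gen_reduced_word[OF A a])
  then have "ws \<noteq> []" using assms by auto
  then obtain vs r where v: "ws = vs @ [r]" by (metis rev_exhaust)
  then have vr: "set vs \<subseteq> S" "r \<in> S" "set vs \<subseteq> A" "r \<in> A" using w A by auto
  then have "a \<otimes> r = ev vs" using w v by (auto simp: ev_append)
  then show thesis using that[of r] vr len_le[OF vr(1)] w v ev_gen[OF A vr(3)] by simp
qed

lemma minrep_if_no_descent:
  assumes x: "x \<in> carrier W" and A: "A \<subseteq> S" and nd: "\<And>r. r \<in> A \<Longrightarrow> len x < len (x \<otimes> r)"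
  shows "minrep x A"
proof -
  obtain g a where g: "g \<in> carrier W" "a \<in> generate W A" "x = g \<otimes> a" "minrep g A"
    by (rule ex_minrep[OF x A])
  have "a = \<one>"
  proof (rule ccontr)
    assume "a \<noteq> \<one>"
    then obtain r where r: "r \<in> A" "len (a \<otimes> r) < len a" "a \<otimes> r \<in> generate W A"
      by (rule last_descent[OF A g(2)])
    have "x \<otimes> r = g \<otimes> (a \<otimes> r)" using g r A gen_closed[OF A g(2)] by (auto simp: m_assoc)
    then have "len (x \<otimes> r) < len x" using minrep_len[OF g(1) A g(4)] g r by simp
    then show False using nd[OF r(1)] by simp
  qed
  then show ?thesis using g by simp
qed

text \<open>After the descent \<open>s\<close> is removed, \<open>s\<close> is no longer a descent,
  so the next one is \<open>t\<close>. Length and one descent thus determine the element.\<close>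

lemma dihedral_eq_alt:
  "\<lbrakk>s \<in> S; t \<in> S; a \<in> generate W {s, t}; len (a \<otimes> s) < len a\<rbrakk> \<Longrightarrow> a = ev (alt (len a) s t)"
proof (induction "len a" arbitrary: a s t)
  case (Suc n)
  have st: "{s, t} \<subseteq> S" using Suc.prems by auto
  have a: "a \<in> carrier W" using gen_closed[OF st Suc.prems(3)] .
  have n: "len (a \<otimes> s) = n" using len_snoc_less[OF a Suc.prems(1,4)] Suc.hyps(2) by simp
  have b: "a \<otimes> s \<in> generate W {s, t}"
    using Suc.prems(3) by (intro gen_mult) (auto intro: generate.incl)
  have "a \<otimes> s = ev (alt n t s)"
  proof (cases "a \<otimes> s = \<one>")
    case True
    then show ?thesis using n by simp
  next
    case False
    then obtain r where r: "r \<in> {s, t}" "len (a \<otimes> s \<otimes> r) < len (a \<otimes> s)"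
      by (rule last_descent[OF st b])
    have "r \<noteq> s" using r(2) n Suc.hyps(2) a Suc.prems(1) by auto
    then have "len (a \<otimes> s \<otimes> t) < len (a \<otimes> s)" using r by auto
    then show ?thesis using Suc.hyps(1)[of "a \<otimes> s" t s] n b Suc.prems by (simp add: insert_commute)
  qed
  then have "a \<otimes> s \<otimes> s = ev (alt n t s) \<otimes> s" by simp
  then have "a = ev (alt n t s) \<otimes> s" using a Suc.prems by simp
  moreover have "set (alt n t s) \<subseteq> S" using set_alt[of n t s] st by blast
  ultimately show ?case using Suc.prems Suc.hyps(2)[symmetric] by (simp add: ev_append)
qed simp

text \<open>Lengths add in \<open>x = g a\<close> with \<open>a\<close> in the dihedral subgroup, so
  both descents pass to \<open>a\<close>, which would equal both alternating words of its
  length.\<close>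

lemma not_two_descents:
  assumes s: "s \<in> S" and t: "t \<in> S" and m: "m s t = \<infinity>" and x: "x \<in> carrier W"
    and d: "len (x \<otimes> s) < len x" "len (x \<otimes> t) < len x"
  shows False
proof -
  have st: "{s, t} \<subseteq> S" using s t by auto
  obtain g a where g: "g \<in> carrier W" "a \<in> generate W {s, t}" "x = g \<otimes> a" "minrep g {s, t}"
    by (rule ex_minrep[OF x st])
  have desc: "len (a \<otimes> r) < len a" if r: "r \<in> {s, t}" for r
  proof -
    have "a \<otimes> r \<in> generate W {s, t}" using g(2) r by (intro gen_mult) (auto intro: generate.incl)
    moreover have "x \<otimes> r = g \<otimes> (a \<otimes> r)" using g r st gen_closed[OF st g(2)] by (auto simp: m_assoc)
    ultimately show ?thesis
      using minrep_len[OF g(1) st g(4)] g(2,3) d r by auto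
  qed
  have "a = ev (alt (len a) s t)" using dihedral_eq_alt[OF s t g(2)] desc by simp
  moreover have "a = ev (alt (len a) t s)"
    using dihedral_eq_alt[OF t s, of a] g(2) desc by (simp add: insert_commute)
  moreover have "0 < len a" using desc[of s] by simp
  ultimately show False using alt_neq[OF s t m] by metis
qed

text \<open>In the amalgamated product of \<open>\<langle>T - {s}\<rangle>\<close> and \<open>\<langle>T - {t}\<rangle>\<close> the length grows along a
  normal form: the minimal representative of \<open>p\<close> ends in \<open>t\<close>, so it has no descent \<open>s\<close>.\<close>

lemma len_amalgam:
  assumes T: "T \<subseteq> S" and s: "s \<in> T" and t: "t \<in> T" and m: "m s t = \<infinity>"
    and g: "g \<in> carrier W" "minrep g (T - {s})"
    and p: "p \<in> generate W (T - {s})" "p \<notin> generate W (T - {t})"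
    and q: "q \<in> generate W (T - {t})"
  shows "len g < len (g \<otimes> p \<otimes> q)"
proof -
  have sub: "T - {s} \<subseteq> S" "T - {t} \<subseteq> S" "T - {s, t} \<subseteq> S" "s \<in> S" "t \<in> S" using T s t by auto
  have pc: "p \<in> carrier W" using gen_closed[OF sub(1) p(1)] .
  obtain p' c where c: "p' \<in> carrier W" "c \<in> generate W (T - {s, t})" "p = p' \<otimes> c"
    "minrep p' (T - {s, t})"
    by (rule ex_minrep[OF pc sub(3)])
  have cc: "c \<in> carrier W" using gen_closed[OF sub(3) c(2)] .
  have cPQ: "c \<in> generate W (T - {s})" "c \<in> generate W (T - {t})"
    by (rule gen_mono[OF _ c(2)]; fastforce)+
  have "p' = p \<otimes> inv c" using c cc by (simp add: m_assoc)
  then have p'P: "p' \<in> generate W (T - {s})"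
    using gen_mult[OF p(1) gen_inv[OF sub(1) cPQ(1)]] by simp
  have "p' \<noteq> \<one>" using c(3) cc cPQ p(2) by auto
  then obtain r where r: "r \<in> T - {s}" "len (p' \<otimes> r) < len p'" "p' \<otimes> r \<in> generate W (T - {s})"
    by (rule last_descent[OF sub(1) p'P])
  have "r \<notin> T - {s, t}"
  proof
    assume "r \<in> T - {s, t}"
    then have "len p' \<le> len (p' \<otimes> r)" using c(4) by (simp add: minrep_def generate.incl)
    then show False using r by simp
  qed
  then have rt: "r = t" using r by auto
  define x where "x = g \<otimes> p'"
  have x: "x \<in> carrier W" using g c by (simp add: x_def)
  have lenx: "len (x \<otimes> y) = len g + len (p' \<otimes> y)" if "y \<in> generate W (T - {s})" for y
    using minrep_len[OF g(1) sub(1) g(2) gen_mult[OF p'P that]] g c gen_closed[OF sub(1) that]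
    by (simp add: x_def m_assoc)
  have lx: "len x = len g + len p'"
    using minrep_len[OF g(1) sub(1) g(2) p'P] by (simp add: x_def)
  have xt: "len (x \<otimes> t) < len x"
    using lenx[of t] lx r rt by (simp add: generate.incl)
  have "minrep x (T - {t})"
  proof (rule minrep_if_no_descent[OF x sub(2)])
    fix y assume y: "y \<in> T - {t}"
    then have yS: "y \<in> S" using T by auto
    have "\<not> len (x \<otimes> y) < len x"
    proof (cases "y = s")
      case True
      then show ?thesis using not_two_descents[OF sub(4,5) m x] xt by blast
    next
      case False
      then have "len p' \<le> len (p' \<otimes> y)" "y \<in> generate W (T - {s})"
        using c(4) y by (simp_all add: minrep_def generate.incl)
      then show ?thesis using lenx[of y] lx by simp
    qed
    then show "len x < len (x \<otimes> y)" using len_snoc_less_or[OF x yS] by auto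
  qed
  \<comment> \<open>The remainder \<open>c\<close> lies in both factors and is passed on to
    \<open>q\<close>.\<close>
  then have "len x \<le> len (x \<otimes> (c \<otimes> q))"
    using gen_mult[OF cPQ(2) q] by (simp add: minrep_def)
  moreover have "x \<otimes> (c \<otimes> q) = g \<otimes> p \<otimes> q"
    using g c cc gen_closed[OF sub(2) q] by (simp add: x_def m_assoc)
  moreover have "len p' \<noteq> 0" using len_0 c \<open>p' \<noteq> \<one>\<close> by blast
  ultimately show ?thesis using lx by simp
qed

end

section \<open>The Bass--Serre tree of a pair of generators of infinite order\<close>

lemma (in group) l_coset_eq_iff:
  assumes "subgroup H G" "g \<in> carrier G" "h \<in> carrier G"
  shows "g <# H = h <# H \<longleftrightarrow> inv h \<otimes> g \<in> H"
proof
  assume eq: "g <# H = h <# H"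
  have "g \<otimes> \<one> \<in> g <# H" using subgroup.one_closed[OF assms(1)] unfolding l_coset_def by blast
  then obtain a where "a \<in> H" "g = h \<otimes> a" using eq assms by (auto simp: l_coset_def)
  then show "inv h \<otimes> g \<in> H" using assms subgroup.mem_carrier[OF assms(1)] by (simp add: m_assoc[symmetric])
next
  assume a: "inv h \<otimes> g \<in> H"
  have "h <# H = h <# ((inv h \<otimes> g) <# H)" using coset_join3[OF _ assms(1) a] assms by simp
  also have "\<dots> = g <# H"
    using assms subgroup.subset[OF assms(1)] by (simp add: lcos_m_assoc m_assoc[symmetric])
  finally show "g <# H = h <# H" by simp
qed

lemma (in group) conj_mult:
  assumes "g \<in> carrier G" "x \<in> carrier G" "y \<in> carrier G"
  shows "(inv g \<otimes> x \<otimes> g) \<otimes> (inv g \<otimes> y \<otimes> g) = inv g \<otimes> (x \<otimes> y) \<otimes> g"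
proof -
  have "(inv g \<otimes> x \<otimes> g) \<otimes> (inv g \<otimes> y \<otimes> g) = inv g \<otimes> x \<otimes> (g \<otimes> inv g) \<otimes> (y \<otimes> g)"
    using assms by (simp only: m_assoc m_closed inv_closed)
  then show ?thesis using assms by (simp add: m_assoc)
qed

lemma (in group) conj_conj:
  assumes "g \<in> carrier G" "k \<in> carrier G" "x \<in> carrier G"
  shows "inv (g \<otimes> k) \<otimes> x \<otimes> (g \<otimes> k) = inv k \<otimes> (inv g \<otimes> x \<otimes> g) \<otimes> k"
  using assms by (simp add: inv_mult_group m_assoc)

locale coxeter_split = coxeter +
  fixes T :: "'a set" and s t :: 'a
  assumes T: "T \<subseteq> S" and s: "s \<in> T" and t: "t \<in> T" and infinite: "m s t = \<infinity>"
begin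

definition fac :: "bool \<Rightarrow> 'a set" where "fac b = T - {if b then s else t}"

definition vertex :: "'a \<Rightarrow> bool \<Rightarrow> 'a set \<times> bool" where
  "vertex g b = (g <# generate W (fac b), b)"

definition V :: "('a set \<times> bool) set" where
  "V = {vertex g b | g b. g \<in> generate W T}"

definition E :: "(('a set \<times> bool) \<times> ('a set \<times> bool)) set" where
  "E = {(vertex g True, vertex g False) | g. g \<in> generate W T}"

text \<open>The parity term separates adjacent vertices.\<close>

definition height :: "'a set \<times> bool \<Rightarrow> nat" where
  "height v = 2 * (LEAST n. \<exists>x\<in>fst v. len x = n) + (if snd v then 0 else 1)"

lemma fac_T: "fac b \<subseteq> T" and fac_S: "fac b \<subseteq> S"
  using T by (auto simp: fac_def)

lemma s_neq_t: "s \<noteq> t"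
proof
  assume "s = t"
  then have "m s t = 1" using s T by auto
  then show False using infinite by simp
qed

lemma T_closed: "x \<in> generate W T \<Longrightarrow> x \<in> carrier W"
  by (rule gen_closed[OF T])

lemma fac_closed: "x \<in> generate W (fac b) \<Longrightarrow> x \<in> carrier W"
  by (rule gen_closed[OF fac_S])

lemma fac_gen_T: "x \<in> generate W (fac b) \<Longrightarrow> x \<in> generate W T"
  by (rule gen_mono[OF fac_T])

lemma vertex_eq_iff:
  "\<lbrakk>g \<in> carrier W; h \<in> carrier W\<rbrakk> \<Longrightarrow>
    vertex g b = vertex h c \<longleftrightarrow> b = c \<and> inv h \<otimes> g \<in> generate W (fac b)"
  unfolding vertex_def using l_coset_eq_iff[OF gen_subgroup[OF fac_S]] by auto

lemma vertex_mult:
  "\<lbrakk>g \<in> carrier W; p \<in> generate W (fac b)\<rbrakk> \<Longrightarrow> vertex (g \<otimes> p) b = vertex g b"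
  using fac_closed by (simp add: vertex_eq_iff m_assoc[symmetric])

lemma vertex_minrep:
  assumes g: "g \<in> generate W T"
  obtains h where "h \<in> generate W T" "vertex h b = vertex g b" "minrep h (fac b)"
proof -
  obtain h a where h: "h \<in> carrier W" "a \<in> generate W (fac b)" "g = h \<otimes> a" "minrep h (fac b)"
    by (rule ex_minrep[OF T_closed[OF g] fac_S])
  have "h = g \<otimes> inv a" using h fac_closed by (simp add: m_assoc)
  then have "h \<in> generate W T" using gen_mult[OF g] gen_inv[OF T fac_gen_T[OF h(2)]] by simp
  then show thesis using that[of h] h vertex_mult by simp
qed

lemma height_minrep:
  assumes "g \<in> carrier W" "minrep g (fac b)"
  shows "height (vertex g b) = 2 * len g + (if b then 0 else 1)"
proof -
  have "g \<otimes> \<one> \<in> g <# generate W (fac b)" unfolding l_coset_def using generate.one by blast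
  then have "\<exists>x\<in>g <# generate W (fac b). len x = len g" using assms(1) by (intro bexI[of _ g]) auto
  then have "(LEAST n. \<exists>x\<in>g <# generate W (fac b). len x = n) = len g"
    using assms by (intro Least_equality) (auto simp: l_coset_def minrep_def)
  then show ?thesis by (simp add: height_def vertex_def)
qed

lemma len_split:
  assumes "g \<in> carrier W" "minrep g (fac b)" "p \<in> generate W (fac b)" "p \<notin> generate W (fac (\<not> b))"
    "q \<in> generate W (fac (\<not> b))"
  shows "len g < len (g \<otimes> p \<otimes> q)"
proof (cases b)
  case True
  then show ?thesis using len_amalgam[OF T s t infinite] assms by (simp add: fac_def)
next
  case False
  have "m t s = \<infinity>" using m_sym[of s t] infinite s t T by (metis subsetD)
  from len_amalgam[OF T t s this] show ?thesis using False assms by (simp add: fac_def)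
qed

lemma adjacent_vertices: "(vertex g b, y) \<in> E \<union> E\<inverse> \<longleftrightarrow>
    (\<exists>k\<in>generate W T. vertex k b = vertex g b \<and> y = vertex k (\<not> b))"
  by (cases b) (auto simp: E_def vertex_def)

text \<open>Neighbours arise from \<open>g p\<close> with \<open>p\<close> in the factor. Unless
  \<open>p\<close> lies in both factors, \<open>len_split\<close> makes every element of the
  neighbouring coset longer than \<open>g\<close>, and a gain of one outweighs the parity
  term.\<close>

lemma lower_neighbour:
  assumes g: "g \<in> generate W T" "minrep g (fac b)"
    and y: "(vertex g b, y) \<in> E \<union> E\<inverse>" "height y < height (vertex g b)"
  shows "y = vertex g (\<not> b)"
proof -
  have gc: "g \<in> carrier W" using T_closed[OF g(1)] .
  obtain k where k: "k \<in> generate W T" "vertex k b = vertex g b" "y = vertex k (\<not> b)"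
    using y adjacent_vertices by blast
  have kc: "k \<in> carrier W" using T_closed[OF k(1)] .
  define p where "p = inv g \<otimes> k"
  have p: "p \<in> generate W (fac b)" "k = g \<otimes> p"
    using k(2) gc kc by (simp_all add: vertex_eq_iff p_def m_assoc[symmetric])
  have "p \<in> generate W (fac (\<not> b))"
  proof (rule ccontr)
    assume p': "p \<notin> generate W (fac (\<not> b))"
    obtain h where h: "h \<in> generate W T" "vertex h (\<not> b) = vertex k (\<not> b)" "minrep h (fac (\<not> b))"
      by (rule vertex_minrep[OF k(1)])
    have hc: "h \<in> carrier W" using T_closed[OF h(1)] .
    have q: "inv k \<otimes> h \<in> generate W (fac (\<not> b))" using h(2) hc kc by (simp add: vertex_eq_iff)
    have "h = g \<otimes> p \<otimes> (inv k \<otimes> h)" using hc kc p(2) by (simp add: m_assoc[symmetric])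
    then have "len g < len h" using len_split[OF gc g(2) p(1) p' q] by simp
    then show False
      using y(2) height_minrep[OF gc g(2)] height_minrep[OF hc h(3)] h(2) k(3) by (auto split: if_splits)
  qed
  then show ?thesis using vertex_mult[OF gc] k(3) p(2) by simp
qed

text \<open>As \<open>s\<close> and \<open>t\<close> differ, each letter lies in one of the factors;
  appending it leaves the vertex of that kind in place.\<close>

lemma T_word_connected:
  "set ws \<subseteq> T \<Longrightarrow> (vertex \<one> True, vertex (ev ws) b) \<in> (E \<union> E\<inverse>)\<^sup>*"
proof (induction ws arbitrary: b rule: rev_induct)
  case Nil
  have "(vertex \<one> True, vertex \<one> False) \<in> E" by (auto simp: E_def intro: generate.one)
  then show ?case by (cases b) auto
next
  case (snoc x ws)
  have w: "set ws \<subseteq> T" "set ws \<subseteq> S" "x \<in> T" "x \<in> S" using snoc.prems T by auto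
  have e: "ev (ws @ [x]) = ev ws \<otimes> x" using w by (simp add: ev_append)
  have "x \<in> fac True \<or> x \<in> fac False" using w(3) s_neq_t by (auto simp: fac_def)
  then obtain c where "x \<in> fac c" by blast
  then have "vertex (ev (ws @ [x])) c = vertex (ev ws) c"
    unfolding e using w by (intro vertex_mult) (auto intro: generate.incl)
  then have c: "(vertex \<one> True, vertex (ev (ws @ [x])) c) \<in> (E \<union> E\<inverse>)\<^sup>*"
    using snoc.IH[OF w(1)] by simp
  have "ev (ws @ [x]) \<in> generate W T" using ev_gen[OF T snoc.prems] .
  then have "(vertex (ev (ws @ [x])) c, vertex (ev (ws @ [x])) (\<not> c)) \<in> E \<union> E\<inverse>"
    using adjacent_vertices by blast
  with c have "(vertex \<one> True, vertex (ev (ws @ [x])) (\<not> c)) \<in> (E \<union> E\<inverse>)\<^sup>*"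
    by (rule rtrancl_into_rtrancl)
  with c show ?case by (cases "b = c") auto
qed

lemma tree: "directed_tree V E"
proof (rule directed_treeI_height[where h = height])
  show "V \<noteq> {}" unfolding V_def using generate.one by blast
  show "E \<subseteq> V \<times> V" by (auto simp: E_def V_def)
  show "(vertex \<one> True, x) \<in> (E \<union> E\<inverse>)\<^sup>*" if "x \<in> V" for x
    using that T_word_connected generate_eq_ev[OF T] by (auto simp: V_def)
  show "asym E" by (rule asymI) (auto simp: E_def vertex_def)
  show "height x \<noteq> height y" if "(x, y) \<in> E" for x y
  proof -
    have "even (height x)" "odd (height y)" using that by (auto simp: E_def vertex_def height_def)
    then show ?thesis by auto
  qed
  show "y = z" if yz: "(v, y) \<in> E \<union> E\<inverse>" "(v, z) \<in> E \<union> E\<inverse>" "height y < height v" "height z < height v"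
    for v y z
  proof -
    have "v \<in> V" using yz(1) by (auto simp: E_def V_def)
    then obtain g b where "g \<in> generate W T" "v = vertex g b" by (auto simp: V_def)
    then obtain h where "h \<in> generate W T" "v = vertex h b" "minrep h (fac b)"
      using vertex_minrep by metis
    then show ?thesis using lower_neighbour yz by metis
  qed
qed

text \<open>The parameter \<open>f\<close> allows the identity for subgroups of \<open><T>\<close>,
  and a conjugation for subgroups that lie in \<open><T>\<close> only after conjugation.\<close>

definition coset_act :: "('c \<Rightarrow> 'a) \<Rightarrow> 'c \<Rightarrow> 'a set \<times> bool \<Rightarrow> 'a set \<times> bool" where
  "coset_act f h = (\<lambda>v\<in>V. (f h <# fst v, snd v))"

lemma coset_act_vertex:
  "\<lbrakk>f h \<in> generate W T; g \<in> generate W T\<rbrakk> \<Longrightarrow> coset_act f h (vertex g b) = vertex (f h \<otimes> g) b"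
  using T_closed subgroup.subset[OF gen_subgroup[OF fac_S]]
  by (auto simp: coset_act_def V_def vertex_def lcos_m_assoc)

lemma coset_act_acts:
  assumes G: "group G" and f: "\<And>h. h \<in> carrier G \<Longrightarrow> f h \<in> generate W T"
    and mult: "\<And>h k. h \<in> carrier G \<Longrightarrow> k \<in> carrier G \<Longrightarrow> f (h \<otimes>\<^bsub>G\<^esub> k) = f h \<otimes> f k"
  shows "acts_on_tree G V E (coset_act f)"
proof (rule acts_on_treeI[OF G tree])
  interpret G: group G by (rule G)
  have fc: "f h \<in> carrier W" if "h \<in> carrier G" for h using T_closed[OF f[OF that]] .
  have "f \<one>\<^bsub>G\<^esub> \<otimes> f \<one>\<^bsub>G\<^esub> = f \<one>\<^bsub>G\<^esub>" using mult[of "\<one>\<^bsub>G\<^esub>" "\<one>\<^bsub>G\<^esub>"] by simp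
  then have one: "f \<one>\<^bsub>G\<^esub> = \<one>" using fc[OF G.one_closed] by simp
  show "coset_act f h \<in> extensional V" for h by (simp add: coset_act_def)
  show "coset_act f h x \<in> V" if h: "h \<in> carrier G" and x: "x \<in> V" for h x
  proof -
    obtain g b where g: "x = vertex g b" "g \<in> generate W T" using x by (auto simp: V_def)
    show ?thesis
      unfolding g(1) coset_act_vertex[of f, OF f[OF h] g(2)] using gen_mult[OF f[OF h] g(2)] by (auto simp: V_def)
  qed
  show "coset_act f \<one>\<^bsub>G\<^esub> x = x" if x: "x \<in> V" for x
  proof -
    obtain g b where g: "x = vertex g b" "g \<in> generate W T" using x by (auto simp: V_def)
    show ?thesis
      unfolding g(1) coset_act_vertex[of f, OF f[OF G.one_closed] g(2)] one using T_closed[OF g(2)] by simp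
  qed
  show "coset_act f (h \<otimes>\<^bsub>G\<^esub> k) x = coset_act f h (coset_act f k x)"
    if h: "h \<in> carrier G" and k: "k \<in> carrier G" and x: "x \<in> V" for h k x
  proof -
    obtain g b where g: "x = vertex g b" "g \<in> generate W T" using x by (auto simp: V_def)
    show ?thesis
      unfolding g(1) coset_act_vertex[of f, OF f[OF k] g(2)] coset_act_vertex[of f, OF f[OF G.m_closed[OF h k]] g(2)]
        coset_act_vertex[of f, OF f[OF h] gen_mult[OF f[OF k] g(2)]] mult[OF h k]
      using fc h k T_closed[OF g(2)] by (simp add: m_assoc)
  qed
  show "(coset_act f h x, coset_act f h y) \<in> E" if h: "h \<in> carrier G" and e: "(x, y) \<in> E" for h x y
  proof -
    obtain g where g: "x = vertex g True" "y = vertex g False" "g \<in> generate W T"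
      using e by (auto simp: E_def)
    show ?thesis
      unfolding g(1,2) coset_act_vertex[of f, OF f[OF h] g(3)] using gen_mult[OF f[OF h] g(3)] by (auto simp: E_def)
  qed
qed

lemma coset_act_fixes_iff:
  assumes "f h \<in> generate W T" "g \<in> generate W T"
  shows "coset_act f h (vertex g b) = vertex g b \<longleftrightarrow> inv g \<otimes> f h \<otimes> g \<in> generate W (fac b)"
  using coset_act_vertex[of f h g, OF assms] T_closed[OF assms(1)] T_closed[OF assms(2)]
  by (simp add: vertex_eq_iff m_assoc)

lemma FA_in_factor:
  assumes G: "group G" "FA G" and f: "\<And>h. h \<in> carrier G \<Longrightarrow> f h \<in> generate W T"
    and mult: "\<And>h k. h \<in> carrier G \<Longrightarrow> k \<in> carrier G \<Longrightarrow> f (h \<otimes>\<^bsub>G\<^esub> k) = f h \<otimes> f k"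
  shows "\<exists>g\<in>generate W T. \<exists>b. \<forall>h\<in>carrier G. inv g \<otimes> f h \<otimes> g \<in> generate W (fac b)"
proof -
  have act: "acts_on_tree G V E (coset_act f)" using G(1) f mult by (rule coset_act_acts)
  obtain v where v: "v \<in> V" "\<And>h. h \<in> carrier G \<Longrightarrow> coset_act f h v = v"
    using FA_fixed_vertex[OF G(2) act] by blast
  then obtain g b where g: "v = vertex g b" "g \<in> generate W T" by (auto simp: V_def)
  then show ?thesis using v(2) coset_act_fixes_iff[of f, OF f g(2)] by blast
qed

text \<open>The gain is the location of \<open>g\<close>: neighbours of the base vertex are cosets
  \<open>g <fac False>\<close> with \<open>g\<close> in \<open><fac True>\<close>, so the new
  conjugation takes place in a smaller special subgroup.\<close>

lemma fixes_neighbour: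
  assumes A: "A \<subseteq> fac True" and k: "k \<in> generate W T"
    and fix_k: "\<And>a. a \<in> generate W A \<Longrightarrow> inv k \<otimes> a \<otimes> k \<in> generate W (fac b)"
    and neq: "vertex k b \<noteq> vertex \<one> True"
  shows "\<exists>g\<in>generate W (fac True). \<forall>a\<in>generate W A. inv g \<otimes> a \<otimes> g \<in> generate W (fac False)"
proof -
  have AS: "A \<subseteq> S" using A fac_S by blast
  let ?G = "W\<lparr>carrier := generate W A\<rparr>"
  have AT: "a \<in> generate W T" if "a \<in> generate W A" for a
    using gen_mono[OF subset_trans[OF A fac_T] that] .
  have "group ?G" using subgroup.subgroup_is_group[OF gen_subgroup[OF AS] is_group] .
  then have "acts_on_tree ?G V E (coset_act id)" by (rule coset_act_acts) (use AT in auto)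
  then interpret tree_action V E ?G "coset_act id" by (rule tree_actionI)
  have one: "\<one> \<in> generate W T" by (rule generate.one)
  have V: "vertex \<one> True \<in> V" "vertex k b \<in> V" using one k by (auto simp: V_def)
  have fixed: "coset_act id a (nx (vertex \<one> True) (vertex k b)) = nx (vertex \<one> True) (vertex k b)"
    if a: "a \<in> generate W A" for a
  proof (rule nx_fixed[OF _ V neq[symmetric]])
    have "id a \<in> generate W T" using AT a by simp
    note iff = coset_act_fixes_iff[of id a, OF this]
    show "coset_act id a (vertex \<one> True) = vertex \<one> True"
      using iff[OF one] gen_mono[OF A a] fac_closed by simp
    show "coset_act id a (vertex k b) = vertex k b" using iff[OF k] fix_k[OF a] by simp
  qed (use a in simp)
  have "(vertex \<one> True, nx (vertex \<one> True) (vertex k b)) \<in> E \<union> E\<inverse>"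
    using nx(1)[OF V neq[symmetric]] by (simp add: R_def)
  then obtain g where g: "g \<in> generate W T" "vertex g True = vertex \<one> True"
    "nx (vertex \<one> True) (vertex k b) = vertex g False"
    using adjacent_vertices by auto
  show ?thesis
  proof (intro bexI[of _ g] ballI)
    show "g \<in> generate W (fac True)" using g(2) T_closed[OF g(1)] by (simp add: vertex_eq_iff)
    show "inv g \<otimes> a \<otimes> g \<in> generate W (fac False)" if a: "a \<in> generate W A" for a
      using fixed[OF a] coset_act_fixes_iff[of id a g False] AT[OF a] g by simp
  qed
qed

end

section \<open>Special subgroups and property FA\<close>

text \<open>Actions pull back along \<open>f\<close>. The two groups may have different element
  types, hence the appeal to \<open>FA_fixed_vertex\<close>.\<close>

lemma FA_surj_image:
  assumes "group G" "group G'" and FA: "FA G" and f: "f \<in> hom G G'" "f ` carrier G = carrier G'"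
  shows "FA G'"
  unfolding FA_def
proof (intro allI impI)
  fix V :: "('c \<times> 'c \<times> nat) set" and E \<phi>
  assume act: "acts_on_tree G' V E \<phi>"
  note A = acts_on_treeD[OF act]
  interpret G: group G by fact
  interpret G': group G' by fact
  interpret group_hom G G' f using f(1) by (simp add: group_hom_def group_hom_axioms_def assms)
  have "acts_on_tree G V E (\<lambda>g. restrict (\<phi> (f g)) V)"
  proof (rule acts_on_treeI[OF assms(1) A(2)])
    show "(restrict (\<phi> (f g)) V x, restrict (\<phi> (f g)) V y) \<in> E"
      if "g \<in> carrier G" "(x, y) \<in> E" for g x y
    proof -
      have "x \<in> V" "y \<in> V" using that A(2) by (auto simp: directed_tree_def)
      then show ?thesis using that A(6) by simp
    qed
  qed (use A(3-5) in simp_all)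
  then obtain v where "v \<in> V" "\<forall>g\<in>carrier G. restrict (\<phi> (f g)) V v = v"
    using FA_fixed_vertex[OF FA] by blast
  then show "\<exists>v\<in>V. \<forall>g\<in>carrier G'. \<phi> g v = v"
    unfolding f(2)[symmetric] by (intro bexI[of _ v]) auto
qed

context coxeter
begin

text \<open>Finitely many letters suffice to write the given generators; they generate
  \<open>W\<close>, and by \<open>S_in_gen\<close> no generator lies outside them.\<close>

lemma finite_S: assumes "finitely_generated W" shows "finite S"
proof -
  obtain X where X: "finite X" "X \<subseteq> carrier W" "generate W X = carrier W"
    using assms by (auto simp: finitely_generated_def)
  have "\<forall>x\<in>X. \<exists>ws. set ws \<subseteq> S \<and> ev ws = x"
    using X(2) reduced_word by (metis subsetD)
  then obtain w where w: "\<And>x. x \<in> X \<Longrightarrow> set (w x) \<subseteq> S \<and> ev (w x) = x" by metis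
  define F where "F = (\<Union>x\<in>X. set (w x))"
  have F: "finite F" "F \<subseteq> S" using X(1) w by (auto simp: F_def)
  have "x \<in> generate W F" if x: "x \<in> X" for x
  proof -
    have "set (w x) \<subseteq> F" using x by (auto simp: F_def)
    then show ?thesis using ev_gen[OF F(2), of "w x"] w[OF x] by simp
  qed
  then have "generate W X \<subseteq> generate W F"
    using generate_subgroup_incl[OF _ gen_subgroup[OF F(2)]] by blast
  then have "S \<subseteq> F" using X(3) S_carrier S_in_gen[OF F(2)] by blast
  then show ?thesis using F(1) finite_subset by blast
qed

section \<open>Complete sets of generators\<close>

definition complete :: "'a set \<Rightarrow> bool" where
  "complete A \<longleftrightarrow> (\<forall>s\<in>A. \<forall>t\<in>A. m s t \<noteq> \<infinity>)"

lemma complete_insert: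
  assumes A: "A \<subseteq> S" "complete A" and x: "x \<in> S" "\<forall>a\<in>A. m x a \<noteq> \<infinity>"
  shows "complete (insert x A)"
proof -
  have "m x x \<noteq> \<infinity>" using x by simp
  moreover have "\<forall>a\<in>A. m a x \<noteq> \<infinity>" using x m_sym A(1) by (metis subsetD)
  ultimately show ?thesis using A(2) x(2) unfolding complete_def by blast
qed

lemma finite_dihedral:
  assumes s: "s \<in> S" and t: "t \<in> S" and m: "m s t \<noteq> \<infinity>"
  shows "finite (generate W {s, t})"
proof -
  obtain n where mn: "m s t = enat n" using m by auto
  have n: "n \<noteq> 0" using m_ge_1[OF s t] mn by (auto simp: one_enat_def)
  define u where "u = s \<otimes> t"
  have c: "s \<in> carrier W" "t \<in> carrier W" "u \<in> carrier W" using s t by (auto simp: u_def)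
  have un: "u [^] n = \<one>" using relation[OF s t mn] by (simp add: u_def)
  define D where "D = range (\<lambda>i::nat. u [^] i) \<union> range (\<lambda>i::nat. u [^] i \<otimes> s)"
  have "u [^] i = u [^] (i mod n)" for i
  proof -
    have "u [^] i = (u [^] n) [^] (i div n) \<otimes> u [^] (i mod n)"
      using c by (simp add: nat_pow_pow nat_pow_mult)
    then show ?thesis using c by (simp add: un)
  qed
  then have "D \<subseteq> (\<lambda>i. u [^] i) ` {..<n} \<union> (\<lambda>i. u [^] i \<otimes> s) ` {..<n}"
    using n unfolding D_def by (metis (no_types, lifting) Un_mono image_eqI image_subsetI lessThan_iff mod_less_divisor neq0_conv)
  then have fin: "finite D" by (rule finite_subset) simp
  have st: "{s, t} \<subseteq> S" using s t by simp
  have step: "x \<otimes> y \<in> D" if x: "x \<in> D" and y: "y \<in> {s, t}" for x y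
  proof -
    have ut: "u [^] i \<otimes> t \<in> D" for i :: nat
    proof -
      \<comment> \<open>Adding the period \<open>n\<close> lets one factor \<open>u\<close> be split
        off even for \<open>i = 0\<close>.\<close>
      obtain j where j: "i + n = Suc j" using n not0_implies_Suc by fastforce
      have "u [^] i = u [^] (i + n)" using c by (simp add: nat_pow_mult[symmetric] un)
      then have "u [^] i \<otimes> t = u [^] j \<otimes> u \<otimes> t" by (simp add: j)
      also have "\<dots> = u [^] j \<otimes> s" using c t s by (simp add: u_def m_assoc)
      finally show ?thesis by (auto simp: D_def)
    qed
    have us: "u [^] i \<otimes> s \<in> D" "u [^] i \<otimes> s \<otimes> s \<in> D" for i :: nat
      using c s by (auto simp: D_def)
    have ust: "u [^] i \<otimes> s \<otimes> t \<in> D" for i :: nat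
    proof -
      have "u [^] i \<otimes> s \<otimes> t = u [^] Suc i" using c by (simp add: u_def m_assoc)
      then show ?thesis unfolding D_def by blast
    qed
    show ?thesis using x y ut us ust by (auto simp: D_def)
  qed
  have "ev ws \<in> D" if "set ws \<subseteq> {s, t}" for ws
    using that
  proof (induction ws rule: rev_induct)
    case Nil
    have "\<one> = u [^] (0::nat)" by simp
    then show ?case unfolding D_def by (metis UnI1 ev_Nil rangeI)
  next
    case (snoc x ws)
    then have "set ws \<subseteq> S" "x \<in> S" using st by auto
    then have "ev (ws @ [x]) = ev ws \<otimes> x" by (simp add: ev_append)
    then show ?case using snoc step by simp
  qed
  then have "generate W {s, t} \<subseteq> D" using generate_eq_ev[OF st] by auto
  then show ?thesis using fin finite_subset by blast
qed

lemma FA_complete: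
  assumes A: "A \<subseteq> S" "finite A" "complete A"
  shows "FA (W\<lparr>carrier := generate W A\<rparr>)"
  unfolding FA_def
proof (intro allI impI)
  let ?G = "W\<lparr>carrier := generate W A\<rparr>"
  fix V :: "('a \<times> 'a \<times> nat) set" and E \<phi>
  assume "acts_on_tree ?G V E \<phi>"
  then interpret act: tree_action V E ?G \<phi> by (rule tree_actionI)
  have "\<exists>v\<in>V. \<forall>s\<in>A. v \<in> {v \<in> V. \<phi> s v = v}"
  proof (rule act.helly[OF A(2)])
    show "act.convex {v \<in> V. \<phi> s v = v}" if "s \<in> A" for s
      using that by (intro act.convex_fixed) (simp add: generate.incl)
    show "{v \<in> V. \<phi> s v = v} \<inter> {v \<in> V. \<phi> t v = v} \<noteq> {}" if st: "s \<in> A" "t \<in> A" for s t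
    proof -
      have sub: "{s, t} \<subseteq> A" "{s, t} \<subseteq> S" using st A by auto
      have "m s t \<noteq> \<infinity>" using A(3) st by (auto simp: complete_def)
      then have "finite (generate W {s, t})" using finite_dihedral sub by simp
      moreover have "subgroup (generate W {s, t}) ?G"
        using subgroup_incl[OF gen_subgroup[OF sub(2)] gen_subgroup[OF A(1)]] mono_generate[OF sub(1)]
        by blast
      ultimately obtain v where "v \<in> V" "\<forall>g\<in>generate W {s, t}. \<phi> g v = v"
        using act.finite_subgroup_fixed_vertex by blast
      then show ?thesis using generate.incl[of _ "{s, t}" W] by auto
    qed
  qed
  then obtain v where v: "v \<in> V" "\<And>s. s \<in> A \<Longrightarrow> \<phi> s v = v" by auto
  have "\<phi> (ev ws) v = v" if "set ws \<subseteq> A" for ws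
    using that
  proof (induction ws)
    case Nil
    then show ?case using act.one[OF v(1)] by simp
  next
    case (Cons s ws)
    have "\<phi> (s \<otimes> ev ws) v = \<phi> s (\<phi> (ev ws) v)"
      using act.mult[of s "ev ws" v] Cons.prems v ev_gen[OF A(1), of ws] by (simp add: generate.incl)
    then show ?case using Cons v by simp
  qed
  then show "\<exists>v\<in>V. \<forall>g\<in>carrier ?G. \<phi> g v = v"
    using v(1) generate_eq_ev[OF A(1)] by auto
qed

text \<open>The conjugator is kept as \<open>g\<close> followed by some \<open>k\<close> in
  \<open><T>\<close>: \<open>g\<close> collects the earlier steps of the descent, and the location
  of \<open>k\<close> is what \<open>complete_rigid\<close> relies on.\<close>

lemma FA_in_complete:
  assumes H: "subgroup H W" "FA (W\<lparr>carrier := H\<rparr>)"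
  shows "\<lbrakk>finite T; T \<subseteq> S; g \<in> carrier W; \<forall>h\<in>H. inv g \<otimes> h \<otimes> g \<in> generate W T\<rbrakk> \<Longrightarrow>
    \<exists>k\<in>generate W T. \<exists>B\<subseteq>T. complete B \<and>
      (\<forall>h\<in>H. inv (g \<otimes> k) \<otimes> h \<otimes> (g \<otimes> k) \<in> generate W B)"
proof (induction T arbitrary: g rule: finite_psubset_induct)
  case (psubset T)
  have Hc: "h \<in> carrier W" if "h \<in> H" for h using subgroup.mem_carrier[OF H(1) that] .
  show ?case
  proof (cases "complete T")
    case True
    then show ?thesis using psubset.prems
      by (intro bexI[of _ \<one>] exI[of _ T]) (auto intro: generate.one)
  next
    case False
    then obtain s t where st: "s \<in> T" "t \<in> T" "m s t = \<infinity>" by (auto simp: complete_def)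
    interpret sp: coxeter_split W S m T s t
      by unfold_locales (use psubset.prems st in auto)
    have "group (W\<lparr>carrier := H\<rparr>)" using subgroup.subgroup_is_group[OF H(1) is_group] .
    then have "\<exists>k\<in>generate W T. \<exists>b. \<forall>h\<in>carrier (W\<lparr>carrier := H\<rparr>).
        inv k \<otimes> (inv g \<otimes> h \<otimes> g) \<otimes> k \<in> generate W (sp.fac b)"
      by (rule sp.FA_in_factor) (use H(2) psubset.prems Hc conj_mult in simp_all)
    then obtain k b where k: "k \<in> generate W T"
      "\<And>h. h \<in> H \<Longrightarrow> inv k \<otimes> (inv g \<otimes> h \<otimes> g) \<otimes> k \<in> generate W (sp.fac b)" by auto
    have kc: "k \<in> carrier W" using sp.T_closed[OF k(1)] .
    have sub: "sp.fac b \<subset> T" using st by (auto simp: sp.fac_def)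
    have "\<forall>h\<in>H. inv (g \<otimes> k) \<otimes> h \<otimes> (g \<otimes> k) \<in> generate W (sp.fac b)"
      using k(2) conj_conj[OF psubset.prems(2) kc Hc] by simp
    from psubset.IH[OF sub sp.fac_S m_closed[OF psubset.prems(2) kc] this]
    obtain l B where l: "l \<in> generate W (sp.fac b)" "B \<subseteq> sp.fac b" "complete B"
      "\<forall>h\<in>H. inv (g \<otimes> k \<otimes> l) \<otimes> h \<otimes> (g \<otimes> k \<otimes> l) \<in> generate W B" by auto
    have "g \<otimes> k \<otimes> l = g \<otimes> (k \<otimes> l)" using psubset.prems(2) kc sp.fac_closed[OF l(1)] by (simp add: m_assoc)
    moreover have "k \<otimes> l \<in> generate W T" using gen_mult[OF k(1) sp.fac_gen_T[OF l(1)]] .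
    moreover have "B \<subseteq> T" using l(2) sp.fac_T by blast
    ultimately show ?thesis using l(3,4) by metis
  qed
qed

text \<open>If \<open>A \<noteq> T\<close>, choose \<open>s \<in> T - A\<close> and \<open>t \<in> A\<close> spanning no edge. Then \<open>\<langle>A\<rangle>\<close> fixes only the
  base vertex of the tree: otherwise it fixes a neighbour and is conjugate in \<open>\<langle>T - {s}\<rangle>\<close> into
  \<open>\<langle>T - {s, t}\<rangle>\<close>, which by induction is impossible since \<open>t \<in> A\<close>.\<close>

lemma complete_rigid:
  "\<lbrakk>finite T; T \<subseteq> S; A \<subseteq> T; complete A; \<forall>x\<in>T - A. \<exists>a\<in>A. m x a = \<infinity>; B \<subseteq> T; complete B;
    k \<in> generate W T; \<forall>a\<in>generate W A. inv k \<otimes> a \<otimes> k \<in> generate W B\<rbrakk> \<Longrightarrow>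
    A = B \<and> k \<in> generate W A"
proof (induction T arbitrary: B k rule: finite_psubset_induct)
  case (psubset T)
  note T = psubset.prems(1) and A = psubset.prems(2,3) and Amax = psubset.prems(4)
    and B = psubset.prems(5,6) and k = psubset.prems(7) and conj = psubset.prems(8)
  have AS: "A \<subseteq> S" and BS: "B \<subseteq> S" using T A B by auto
  show ?case
  proof (cases "A = T")
    case True
    have kc: "k \<in> carrier W" using gen_closed[OF T k] .
    have "x \<in> B" if x: "x \<in> T" for x
    proof -
      have xc: "x \<in> carrier W" using x T by auto
      have "k \<otimes> x \<otimes> inv k \<in> generate W A"
        using k x gen_inv[OF T k] True by (auto intro!: gen_mult intro: generate.incl)
      then have "inv k \<otimes> (k \<otimes> x \<otimes> inv k) \<otimes> k \<in> generate W B" using conj by blast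
      moreover have "inv k \<otimes> (k \<otimes> x \<otimes> inv k) \<otimes> k = (inv k \<otimes> k) \<otimes> x \<otimes> (inv k \<otimes> k)"
        using kc xc by (simp only: m_assoc m_closed inv_closed)
      ultimately have "x \<in> generate W B" using kc xc by simp
      then show ?thesis using S_in_gen[OF BS] x T by blast
    qed
    then show ?thesis using True B k by auto
  next
    case False
    then obtain s t where st: "s \<in> T - A" "t \<in> A" "m s t = \<infinity>" using Amax A by blast
    interpret sp: coxeter_split W S m T s t
      by unfold_locales (use T A st in auto)
    have facT: "sp.fac True = T - {s}" "sp.fac False = T - {t}" by (simp_all add: sp.fac_def)
    have sub: "sp.fac True \<subset> T" using st by (auto simp: facT)
    have A1: "A \<subseteq> sp.fac True" using A st by (auto simp: facT)
    have A1max: "\<forall>x\<in>sp.fac True - A. \<exists>a\<in>A. m x a = \<infinity>"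
      using Amax sub by blast
    note IH = psubset.IH[OF sub sp.fac_S A1 A(2) A1max]
    \<comment> \<open>A complete \<open>B\<close> cannot contain both \<open>s\<close> and
      \<open>t\<close>, so it lies in one of the factors.\<close>
    define b where "b \<longleftrightarrow> s \<notin> B"
    have "\<not> (s \<in> B \<and> t \<in> B)" using B(2) st(3) unfolding complete_def by blast
    then have Bb: "B \<subseteq> sp.fac b" using B(1) by (auto simp: b_def sp.fac_def)
    have fix_k: "inv k \<otimes> a \<otimes> k \<in> generate W (sp.fac b)" if "a \<in> generate W A" for a
      using gen_mono[OF Bb] conj that by blast
    show ?thesis
    proof (cases "sp.vertex k b = sp.vertex \<one> True")
      case True
      then have b: "b" and kP: "k \<in> generate W (sp.fac True)"
        using sp.vertex_eq_iff[of k \<one> b True] sp.T_closed[OF k] by auto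
      have "B \<subseteq> sp.fac True" using Bb b by simp
      then show ?thesis using IH[OF _ B(2) kP conj] by blast
    next
      case neq: False
      have "\<exists>g\<in>generate W (sp.fac True).
          \<forall>a\<in>generate W A. inv g \<otimes> a \<otimes> g \<in> generate W (sp.fac False)"
        using A1 k fix_k neq by (rule sp.fixes_neighbour)
      then obtain g where g: "g \<in> generate W (sp.fac True)"
        "\<And>a. a \<in> generate W A \<Longrightarrow> inv g \<otimes> a \<otimes> g \<in> generate W (sp.fac False)" by blast
      have gc: "g \<in> carrier W" using sp.fac_closed[OF g(1)] .
      let ?U = "sp.fac True \<inter> sp.fac False"
      have U: "finite ?U" "?U \<subseteq> S" using psubset.hyps T by (auto simp: facT)
      have gU: "\<forall>a\<in>generate W A. inv g \<otimes> a \<otimes> g \<in> generate W ?U"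
      proof
        fix a assume a: "a \<in> generate W A"
        show "inv g \<otimes> a \<otimes> g \<in> generate W ?U"
          using gen_Int[OF sp.fac_S sp.fac_S _ g(2)[OF a]]
            gen_mult[OF gen_mult[OF gen_inv[OF sp.fac_S g(1)] gen_mono[OF A1 a]] g(1)] by simp
      qed
      \<comment> \<open>The set \<open>?U\<close> need not be complete, as the induction hypothesis
        demands of the target. Since \<open><A>\<close> is FA, it can be conjugated further, within
        \<open><?U>\<close>, into a complete \<open>C\<close>.\<close>
      have "finite A" using psubset.hyps A finite_subset by blast
      note FA_A = FA_complete[OF AS this A(2)]
      obtain l C where l: "l \<in> generate W ?U" "C \<subseteq> ?U" "complete C"
        "\<forall>a\<in>generate W A. inv (g \<otimes> l) \<otimes> a \<otimes> (g \<otimes> l) \<in> generate W C"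
        using FA_in_complete[OF gen_subgroup[OF AS] FA_A U gc gU] by blast
      have C: "C \<subseteq> sp.fac True" using l(2) by blast
      have "g \<otimes> l \<in> generate W (sp.fac True)"
        using gen_mult[OF g(1) gen_mono[OF _ l(1), of "sp.fac True"]] by simp
      then have "A = C" using IH[OF C l(3) _ l(4)] by blast
      then show ?thesis using st l(2) by (auto simp: facT)
    qed
  qed
qed

text \<open>Adjoining a single vertex already tests maximality, because a larger complete subgraph
  joins each of its new vertices to all of \<open>A\<close>.\<close>

lemma maximal_complete_iff:
  assumes A: "A \<subseteq> S"
  shows "maximal_complete_subgraph (induced_subgraph (presentation_diagram S m) A)
      (presentation_diagram S m) \<longleftrightarrow> complete A \<and> (\<forall>x\<in>S - A. \<exists>a\<in>A. m x a = \<infinity>)"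
    (is "maximal_complete_subgraph ?D ?\<Gamma> \<longleftrightarrow> _")
proof -
  have edge: "(\<exists>n. ({x, y}, n) \<in> edges ?\<Gamma>) \<longleftrightarrow> m x y \<noteq> \<infinity>"
    if "x \<in> S" "y \<in> S" "x \<noteq> y" for x y
    using that m_sym by (auto simp: presentation_diagram_def doubleton_eq_iff)
  have sub: "subgraph (induced_subgraph ?\<Gamma> B) ?\<Gamma>" if "B \<subseteq> S" for B
    using that by (auto simp: subgraph_def induced_subgraph_def presentation_diagram_def)
  have compl: "complete_graph (induced_subgraph ?\<Gamma> B) \<longleftrightarrow> complete B" if B: "B \<subseteq> S" for B
  proof -
    have "complete_graph (induced_subgraph ?\<Gamma> B) \<longleftrightarrow> (\<forall>x\<in>B. \<forall>y\<in>B. x \<noteq> y \<longrightarrow> m x y \<noteq> \<infinity>)"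
      using B edge unfolding complete_graph_def induced_subgraph_def by (simp add: subset_iff)
    also have "\<dots> \<longleftrightarrow> complete B"
      using B m_self unfolding complete_def by (metis infinity_ne_i1 subsetD)
    finally show ?thesis .
  qed
  show ?thesis
  proof
    assume max: "maximal_complete_subgraph ?D ?\<Gamma>"
    then have cA: "complete A" using compl[OF A] by (simp add: maximal_complete_subgraph_def)
    have "\<exists>a\<in>A. m x a = \<infinity>" if x: "x \<in> S - A" for x
    proof (rule ccontr)
      assume no: "\<not> (\<exists>a\<in>A. m x a = \<infinity>)"
      let ?B = "insert x A"
      have B: "?B \<subseteq> S" using x A by auto
      have "complete ?B"
        using no x by (intro complete_insert[OF A cA]) simp_all
      moreover have "subgraph ?D (induced_subgraph ?\<Gamma> ?B)"
        by (auto simp: subgraph_def induced_subgraph_def)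
      ultimately have "induced_subgraph ?\<Gamma> ?B = ?D"
        using max compl[OF B] sub[OF B] unfolding maximal_complete_subgraph_def by blast
      then show False using x by (auto simp: induced_subgraph_def)
    qed
    then show "complete A \<and> (\<forall>x\<in>S - A. \<exists>a\<in>A. m x a = \<infinity>)" using cA by blast
  next
    assume r: "complete A \<and> (\<forall>x\<in>S - A. \<exists>a\<in>A. m x a = \<infinity>)"
    have "D' = ?D" if D': "subgraph D' ?\<Gamma>" "complete_graph D'" "subgraph ?D D'" for D'
    proof -
      have v: "A \<subseteq> verts D'" "verts D' \<subseteq> S"
        using D' by (auto simp: subgraph_def induced_subgraph_def presentation_diagram_def)
      have "verts D' \<subseteq> A"
      proof
        fix x assume x: "x \<in> verts D'"
        show "x \<in> A"
        proof (rule ccontr)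
          assume xA: "x \<notin> A"
          then obtain a where a: "a \<in> A" "m x a = \<infinity>" using r x v by (metis DiffI subsetD)
          then have xa: "a \<in> verts D'" "x \<noteq> a" "x \<in> S" "a \<in> S" using v x xA A by auto
          then obtain n where "({x, a}, n) \<in> edges D'"
            using D'(2) x unfolding complete_graph_def by metis
          then have "({x, a}, n) \<in> edges ?\<Gamma>" using D'(1) by (auto simp: subgraph_def)
          then show False using edge[OF xa(3,4,2)] a(2) by metis
        qed
      qed
      then have vA: "verts D' = A" using v by blast
      \<comment> \<open>\<open>D'\<close> lies between \<open>?D\<close> and the whole diagram and
        has vertex set \<open>A\<close>, which leaves its edges no freedom.\<close>
      moreover have "edges D' = edges ?D"
        using D'(1,3) vA by (auto simp: subgraph_def induced_subgraph_def)
      ultimately show ?thesis by (simp add: induced_subgraph_def)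
    qed
    then show "maximal_complete_subgraph ?D ?\<Gamma>"
      using sub[OF A] compl[OF A] r unfolding maximal_complete_subgraph_def by blast
  qed
qed

lemma extend_complete:
  assumes "finite S" "B \<subseteq> S" "complete B"
  obtains A where "B \<subseteq> A" "A \<subseteq> S" "complete A" "\<And>x. x \<in> S - A \<Longrightarrow> \<exists>a\<in>A. m x a = \<infinity>"
proof -
  define F where "F = {A. B \<subseteq> A \<and> A \<subseteq> S \<and> complete A}"
  have "finite F" using assms(1) by (simp add: F_def)
  moreover have "F \<noteq> {}" using assms by (auto simp: F_def)
  ultimately obtain A where A: "A \<in> F" and max: "\<And>C. C \<in> F \<Longrightarrow> A \<subseteq> C \<Longrightarrow> A = C"
    using finite_has_maximal by metis
  have "\<exists>a\<in>A. m x a = \<infinity>" if x: "x \<in> S - A" for x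
  proof (rule ccontr)
    assume "\<not> (\<exists>a\<in>A. m x a = \<infinity>)"
    then have "complete (insert x A)"
      using complete_insert[of A x] A x by (auto simp: F_def)
    then have "insert x A \<in> F" using A x by (auto simp: F_def)
    then show False using max x by blast
  qed
  then show thesis using that A by (auto simp: F_def)
qed

section \<open>Conjugates of special subgroups\<close>

lemma conj_set_iff:
  assumes g: "g \<in> carrier W" and A: "A \<subseteq> S"
  shows "x \<in> g <# generate W A #> inv g \<longleftrightarrow> x \<in> carrier W \<and> inv g \<otimes> x \<otimes> g \<in> generate W A"
proof
  assume "x \<in> g <# generate W A #> inv g"
  then obtain a where a: "a \<in> generate W A" "x = g \<otimes> a \<otimes> inv g"
    by (auto simp: l_coset_def r_coset_def)
  have ac: "a \<in> carrier W" using gen_closed[OF A a(1)] .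
  have "inv g \<otimes> x \<otimes> g = (inv g \<otimes> g) \<otimes> a \<otimes> (inv g \<otimes> g)"
    unfolding a(2) using g ac by (simp only: m_assoc m_closed inv_closed)
  then show "x \<in> carrier W \<and> inv g \<otimes> x \<otimes> g \<in> generate W A" using g a ac by simp
next
  assume x: "x \<in> carrier W \<and> inv g \<otimes> x \<otimes> g \<in> generate W A"
  have "g \<otimes> (inv g \<otimes> x \<otimes> g) \<otimes> inv g = (g \<otimes> inv g) \<otimes> x \<otimes> (g \<otimes> inv g)"
    using g x by (simp only: m_assoc m_closed inv_closed)
  then have "x = g \<otimes> (inv g \<otimes> x \<otimes> g) \<otimes> inv g" using g x by simp
  then show "x \<in> g <# generate W A #> inv g"
    using x unfolding l_coset_def r_coset_def by blast
qed

lemma conj_subgroup: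
  assumes g: "g \<in> carrier W" and A: "A \<subseteq> S"
  shows "subgroup (g <# generate W A #> inv g) W"
proof (rule subgroupI)
  show "g <# generate W A #> inv g \<subseteq> carrier W" using conj_set_iff[OF assms] by blast
  have "\<one> \<in> g <# generate W A #> inv g" using conj_set_iff[OF assms] g by (simp add: generate.one)
  then show "g <# generate W A #> inv g \<noteq> {}" by blast
  show "inv x \<in> g <# generate W A #> inv g" if "x \<in> g <# generate W A #> inv g" for x
  proof -
    have x: "x \<in> carrier W" "inv g \<otimes> x \<otimes> g \<in> generate W A" using that conj_set_iff[OF assms] by auto
    have "inv (inv g \<otimes> x \<otimes> g) = inv g \<otimes> inv x \<otimes> g" using x g by (simp add: inv_mult_group m_assoc)
    then show ?thesis using gen_inv[OF A x(2)] x conj_set_iff[OF assms] by simp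
  qed
  show "x \<otimes> y \<in> g <# generate W A #> inv g"
    if "x \<in> g <# generate W A #> inv g" "y \<in> g <# generate W A #> inv g" for x y
    using that conj_set_iff[OF assms] gen_mult[of "inv g \<otimes> x \<otimes> g" A "inv g \<otimes> y \<otimes> g"]
      conj_mult[OF g] by simp
qed

lemma FA_conj_complete:
  assumes g: "g \<in> carrier W" and A: "A \<subseteq> S" "finite A" "complete A"
  shows "FA (W\<lparr>carrier := g <# generate W A #> inv g\<rparr>)"
proof (rule FA_surj_image[OF _ _ FA_complete[OF A], where f = "\<lambda>a. g \<otimes> a \<otimes> inv g"])
  show "group (W\<lparr>carrier := generate W A\<rparr>)"
    using subgroup.subgroup_is_group[OF gen_subgroup[OF A(1)] is_group] .
  show "group (W\<lparr>carrier := g <# generate W A #> inv g\<rparr>)"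
    using subgroup.subgroup_is_group[OF conj_subgroup[OF g A(1)] is_group] .
  have mult: "g \<otimes> (a \<otimes> b) \<otimes> inv g = (g \<otimes> a \<otimes> inv g) \<otimes> (g \<otimes> b \<otimes> inv g)"
    if "a \<in> generate W A" "b \<in> generate W A" for a b
    using conj_mult[of "inv g" a b] g gen_closed[OF A(1)] that by simp
  show "(\<lambda>a. g \<otimes> a \<otimes> inv g) \<in> hom (W\<lparr>carrier := generate W A\<rparr>)
      (W\<lparr>carrier := g <# generate W A #> inv g\<rparr>)"
    by (rule homI) (use mult in \<open>auto simp: l_coset_def r_coset_def\<close>)
  show "(\<lambda>a. g \<otimes> a \<otimes> inv g) ` carrier (W\<lparr>carrier := generate W A\<rparr>) =
      carrier (W\<lparr>carrier := g <# generate W A #> inv g\<rparr>)"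
    by (auto simp: l_coset_def r_coset_def)
qed

lemma FA_in_conj:
  assumes fin: "finite S" and H: "subgroup H W" "FA (W\<lparr>carrier := H\<rparr>)"
  obtains k B where "k \<in> carrier W" "B \<subseteq> S" "complete B" "H \<subseteq> k <# generate W B #> inv k"
proof -
  have Hc: "h \<in> carrier W" if "h \<in> H" for h using subgroup.mem_carrier[OF H(1) that] .
  obtain k B where k: "k \<in> carrier W" "B \<subseteq> S" "complete B"
    "\<forall>h\<in>H. inv (\<one> \<otimes> k) \<otimes> h \<otimes> (\<one> \<otimes> k) \<in> generate W B"
    using FA_in_complete[OF H fin subset_refl one_closed] Hc unfolding generate_S by auto
  have "h \<in> k <# generate W B #> inv k" if h: "h \<in> H" for h
    using k(4) h Hc[OF h] k(1) conj_set_iff[OF k(1,2)] by simp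
  then show thesis using that[OF k(1-3)] by blast
qed

end

theorem theorem26:
  fixes W :: "('a, 'b) monoid_scheme" and S :: "'a set" and m :: "'a \<Rightarrow> 'a \<Rightarrow> enat"
  assumes "finitely_generated W"
    and "coxeter_system W S m"
  shows "{H. maximal_FA_subgroup W H} =
         {g <#\<^bsub>W\<^esub> generate W A #>\<^bsub>W\<^esub> inv\<^bsub>W\<^esub> g | g A.
            g \<in> carrier W \<and> A \<subseteq> S \<and>
            maximal_complete_subgraph (induced_subgraph (presentation_diagram S m) A)
              (presentation_diagram S m)}"
proof -
  interpret coxeter W S m using assms(2) by (rule coxeter.intro)
  have fin: "finite S" using finite_S[OF assms(1)] .
  have finA: "finite A" if "A \<subseteq> S" for A using that fin finite_subset by blast
  have "\<exists>g A. H = g <#\<^bsub>W\<^esub> generate W A #>\<^bsub>W\<^esub> inv\<^bsub>W\<^esub> g \<and> g \<in> carrier W \<and> A \<subseteq> S \<and>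
      complete A \<and> (\<forall>x\<in>S - A. \<exists>a\<in>A. m x a = \<infinity>)" if H: "maximal_FA_subgroup W H" for H
  proof -
    obtain g B where g: "g \<in> carrier W" "B \<subseteq> S" "complete B"
      "H \<subseteq> g <#\<^bsub>W\<^esub> generate W B #>\<^bsub>W\<^esub> inv\<^bsub>W\<^esub> g"
      using FA_in_conj[OF fin, of H] H unfolding maximal_FA_subgroup_def by metis
    obtain A where A: "B \<subseteq> A" "A \<subseteq> S" "complete A" "\<And>x. x \<in> S - A \<Longrightarrow> \<exists>a\<in>A. m x a = \<infinity>"
      using extend_complete[OF fin g(2,3)] by blast
    have "H \<subseteq> g <#\<^bsub>W\<^esub> generate W A #>\<^bsub>W\<^esub> inv\<^bsub>W\<^esub> g"
    proof
      fix h assume "h \<in> H"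
      then have "h \<in> carrier W \<and> inv\<^bsub>W\<^esub> g \<otimes>\<^bsub>W\<^esub> h \<otimes>\<^bsub>W\<^esub> g \<in> generate W B"
        using g(4) conj_set_iff[OF g(1,2)] by blast
      then show "h \<in> g <#\<^bsub>W\<^esub> generate W A #>\<^bsub>W\<^esub> inv\<^bsub>W\<^esub> g"
        using conj_set_iff[OF g(1) A(2)] gen_mono[OF A(1)] by blast
    qed
    \<comment> \<open>This conjugate of \<open><A>\<close> is itself FA, so the maximality of
      \<open>H\<close> turns the inclusion into equality.\<close>
    then have "g <#\<^bsub>W\<^esub> generate W A #>\<^bsub>W\<^esub> inv\<^bsub>W\<^esub> g = H"
      using H conj_subgroup[OF g(1) A(2)] FA_conj_complete[OF g(1) A(2) finA[OF A(2)] A(3)]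
      unfolding maximal_FA_subgroup_def by blast
    then show ?thesis using g(1) A by blast
  qed
  moreover have "maximal_FA_subgroup W (g <#\<^bsub>W\<^esub> generate W A #>\<^bsub>W\<^esub> inv\<^bsub>W\<^esub> g)"
    if g: "g \<in> carrier W" and A: "A \<subseteq> S" "complete A" "\<And>x. x \<in> S - A \<Longrightarrow> \<exists>a\<in>A. m x a = \<infinity>"
    for g A
  proof -
    let ?H = "g <#\<^bsub>W\<^esub> generate W A #>\<^bsub>W\<^esub> inv\<^bsub>W\<^esub> g"
    have "K = ?H" if K: "subgroup K W" "FA (W\<lparr>carrier := K\<rparr>)" "?H \<subseteq> K" for K
    proof -
      obtain k B where k: "k \<in> carrier W" "B \<subseteq> S" "complete B"
        "K \<subseteq> k <#\<^bsub>W\<^esub> generate W B #>\<^bsub>W\<^esub> inv\<^bsub>W\<^esub> k"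
        by (rule FA_in_conj[OF fin K(1,2)])
      \<comment> \<open>Conjugating by \<open>g\<close> reduces the inclusion of \<open>?H\<close>
        in the conjugate of \<open><B>\<close> to the statement that \<open>l\<close> conjugates
        \<open><A>\<close> into \<open><B>\<close>, the situation of \<open>complete_rigid\<close>
        with \<open>T = S\<close>.\<close>
      define l where "l = inv\<^bsub>W\<^esub> g \<otimes>\<^bsub>W\<^esub> k"
      have l: "l \<in> carrier W" "k = g \<otimes>\<^bsub>W\<^esub> l"
        using g k(1) by (simp_all add: l_def m_assoc[symmetric])
      have kx: "inv\<^bsub>W\<^esub> k \<otimes>\<^bsub>W\<^esub> x \<otimes>\<^bsub>W\<^esub> k =
          inv\<^bsub>W\<^esub> l \<otimes>\<^bsub>W\<^esub> (inv\<^bsub>W\<^esub> g \<otimes>\<^bsub>W\<^esub> x \<otimes>\<^bsub>W\<^esub> g) \<otimes>\<^bsub>W\<^esub> l" if "x \<in> carrier W" for x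
        unfolding l(2) using conj_conj[OF g l(1) that] .
      have "inv\<^bsub>W\<^esub> l \<otimes>\<^bsub>W\<^esub> a \<otimes>\<^bsub>W\<^esub> l \<in> generate W B" if a: "a \<in> generate W A" for a
      proof -
        have ac: "a \<in> carrier W" using gen_closed[OF A(1) a] .
        let ?x = "g \<otimes>\<^bsub>W\<^esub> a \<otimes>\<^bsub>W\<^esub> inv\<^bsub>W\<^esub> g"
        have x: "?x \<in> carrier W" using g ac by simp
        have "inv\<^bsub>W\<^esub> g \<otimes>\<^bsub>W\<^esub> ?x \<otimes>\<^bsub>W\<^esub> g =
            (inv\<^bsub>W\<^esub> g \<otimes>\<^bsub>W\<^esub> g) \<otimes>\<^bsub>W\<^esub> a \<otimes>\<^bsub>W\<^esub> (inv\<^bsub>W\<^esub> g \<otimes>\<^bsub>W\<^esub> g)"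
          using g ac by (simp only: m_assoc m_closed inv_closed)
        then have xa: "inv\<^bsub>W\<^esub> g \<otimes>\<^bsub>W\<^esub> ?x \<otimes>\<^bsub>W\<^esub> g = a" using g ac by simp
        then have "?x \<in> ?H" using conj_set_iff[OF g A(1)] x a by simp
        then have "inv\<^bsub>W\<^esub> k \<otimes>\<^bsub>W\<^esub> ?x \<otimes>\<^bsub>W\<^esub> k \<in> generate W B"
          using K(3) k(4) conj_set_iff[OF k(1,2)] by blast
        then show ?thesis using kx[OF x] xa by simp
      qed
      then have AB: "A = B" "l \<in> generate W A"
        using complete_rigid[OF fin subset_refl A(1,2) _ k(2,3)] A(3) l(1) generate_S by auto
      \<comment> \<open>As \<open>l\<close> lies in \<open><A>\<close>, conjugating
        \<open><A>\<close> by \<open>k\<close> or by \<open>g\<close> gives the same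
        subgroup.\<close>
      have "K \<subseteq> ?H"
      proof
        fix x assume "x \<in> K"
        then have x: "x \<in> carrier W" "inv\<^bsub>W\<^esub> k \<otimes>\<^bsub>W\<^esub> x \<otimes>\<^bsub>W\<^esub> k \<in> generate W A"
          using k(4) conj_set_iff[OF k(1,2)] AB by auto
        define y where "y = inv\<^bsub>W\<^esub> g \<otimes>\<^bsub>W\<^esub> x \<otimes>\<^bsub>W\<^esub> g"
        have yc: "y \<in> carrier W" using g x by (simp add: y_def)
        have "inv\<^bsub>W\<^esub> l \<otimes>\<^bsub>W\<^esub> y \<otimes>\<^bsub>W\<^esub> l \<in> generate W A" using x kx by (simp add: y_def)
        then have "l \<otimes>\<^bsub>W\<^esub> (inv\<^bsub>W\<^esub> l \<otimes>\<^bsub>W\<^esub> y \<otimes>\<^bsub>W\<^esub> l) \<otimes>\<^bsub>W\<^esub> inv\<^bsub>W\<^esub> l \<in> generate W A"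
          using AB(2) gen_inv[OF A(1) AB(2)] gen_mult by blast
        moreover have "l \<otimes>\<^bsub>W\<^esub> (inv\<^bsub>W\<^esub> l \<otimes>\<^bsub>W\<^esub> y \<otimes>\<^bsub>W\<^esub> l) \<otimes>\<^bsub>W\<^esub> inv\<^bsub>W\<^esub> l =
            (l \<otimes>\<^bsub>W\<^esub> inv\<^bsub>W\<^esub> l) \<otimes>\<^bsub>W\<^esub> y \<otimes>\<^bsub>W\<^esub> (l \<otimes>\<^bsub>W\<^esub> inv\<^bsub>W\<^esub> l)"
          using l yc by (simp only: m_assoc m_closed inv_closed)
        ultimately have "y \<in> generate W A" using l yc by simp
        then show "x \<in> ?H" using conj_set_iff[OF g A(1)] x by (simp add: y_def)
      qed
      then show ?thesis using K(3) by blast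
    qed
    then show ?thesis
      using conj_subgroup[OF g A(1)] FA_conj_complete[OF g A(1) finA[OF A(1)] A(2)]
      unfolding maximal_FA_subgroup_def by blast
  qed
  ultimately show ?thesis using maximal_complete_iff by (auto; blast)
qed

end
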